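(* Let $F(X,Y)=a_0X^n+a_1X^{n-1}Y+\cdots+a_nY^n$ be a binary form with rational integer coefficients $a_0,\dots,a_n\in\mathbb{Z}$, having non-zero discriminant and degree $n\ge 3$. Let $A_F$ denote the area (Lebesgue measure) of the region $\{(x,y)\in\mathbb{R}^2 : |F(x,y)|\le 1\}$. Then $$A_F\le 3B\!\left(\tfrac13,\tfrac13\right),$$ where $B$ is the Beta function. Moreover, this bound is attained by forms with integer coefficients which are equivalent under $\mathrm{GL}_2(\mathbb{Z})$ to $XY(X-Y)$.
   Context: The discriminant of a binary form $F$ of degree $n$ with factorization $F(X,Y)=\prod_{i=1}^n(\alpha_iX-\beta_iY)$, $\alpha_i,\beta_i\in\mathbb{C}$, is $D_F=\prod_{i<j}(\alpha_i\beta_j-\alpha_j\beta_i)^2$. For $T=\begin{pmatrix}a&b\\c&d\end{pmatrix}$ an invertible matrix, $F_T(X,Y)=F(aX+bY,cX+dY)$; two forms $F,G$ are equivalent under $\mathrm{GL}_2(\mathbb{Z})$ if $G=F_T$ for some $T\in\mathrm{GL}_2(\mathbb{Z})$. *)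

theory Defs
  imports "HOL-Analysis.Analysis" "HOL-Computational_Algebra.Fundamental_Theorem_Algebra"
begin

text \<open>
  A binary form of degree \<open>n\<close> is given by its coefficients \<open>a 0, \<dots>, a n\<close>, where \<open>a i\<close> is the
  coefficient of \<open>X^(n-i) Y^i\<close>. Values \<open>a i\<close> with \<open>i > n\<close> are irrelevant.
\<close>

definition eval_form :: "nat \<Rightarrow> (nat \<Rightarrow> int) \<Rightarrow> 'a::comm_ring_1 \<Rightarrow> 'a \<Rightarrow> 'a" where
  "eval_form n a x y = (\<Sum>i\<le>n. of_int (a i) * x ^ (n - i) * y ^ i)"

definition linear_factorization ::
  "nat \<Rightarrow> (nat \<Rightarrow> int) \<Rightarrow> (nat \<Rightarrow> complex) \<Rightarrow> (nat \<Rightarrow> complex) \<Rightarrow> bool" where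
  "linear_factorization n a \<alpha> \<beta> \<longleftrightarrow>
     (\<forall>x y. eval_form n a x y = (\<Prod>i<n. \<alpha> i * x - \<beta> i * y))"

definition disc_of_factors :: "nat \<Rightarrow> (nat \<Rightarrow> complex) \<Rightarrow> (nat \<Rightarrow> complex) \<Rightarrow> complex" where
  "disc_of_factors n \<alpha> \<beta> = (\<Prod>j<n. \<Prod>i<j. (\<alpha> i * \<beta> j - \<alpha> j * \<beta> i)\<^sup>2)"

text \<open>
  The description is proper for \<open>n \<ge> 1\<close>: see \<open>linear_factorization_exists\<close> and
  \<open>form_disc_eq\<close> below.
\<close>

definition form_disc :: "nat \<Rightarrow> (nat \<Rightarrow> int) \<Rightarrow> complex" where
  "form_disc n a =
     (THE D. \<exists>\<alpha> \<beta>. linear_factorization n a \<alpha> \<beta> \<and> D = disc_of_factors n \<alpha> \<beta>)"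

text \<open>
  The area takes values in the extended nonnegative reals, so an upper bound on it includes
  the finiteness of the area.
\<close>

definition form_area :: "nat \<Rightarrow> (nat \<Rightarrow> int) \<Rightarrow> ennreal" where
  "form_area n a = emeasure lborel {(x::real, y::real). \<bar>eval_form n a x y\<bar> \<le> 1}"

text \<open>
  \<open>invertible\<close> refers to inverses with integer entries. The identity \<open>G = F\<^sub>T\<close> between
  polynomials is expressed by the values at integer points, which determine a polynomial.
\<close>

definition GL2Z_equivalent :: "nat \<Rightarrow> (nat \<Rightarrow> int) \<Rightarrow> (nat \<Rightarrow> int) \<Rightarrow> bool" where
  "GL2Z_equivalent n F G \<longleftrightarrow>
     (\<exists>T :: int^2^2. invertible T \<and>
        (\<forall>x y :: int. eval_form n G x y =
           eval_form n F (T $ 1 $ 1 * x + T $ 1 $ 2 * y) (T $ 2 $ 1 * x + T $ 2 $ 2 * y)))"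

definition xy_form :: "nat \<Rightarrow> int" where
  "xy_form = (\<lambda>_. 0)(1 := 1, 2 := -1)"

lemma eval_xy_form: "eval_form 3 xy_form x y = x * y * (x - y)"
  by (simp add: eval_form_def xy_form_def eval_nat_numeral algebra_simps)


subsection \<open>Existence of a factorization\<close>

lemma complex_form_factorization:
  fixes c :: "nat \<Rightarrow> complex"
  assumes "n \<ge> 1"
  shows "\<exists>\<alpha> \<beta>. \<forall>x y. (\<Sum>i\<le>n. c i * x ^ (n - i) * y ^ i) = (\<Prod>i<n. \<alpha> i * x - \<beta> i * y)"
  using assms
proof (induction n arbitrary: c rule: nat_induct_at_least)
  case base
  show ?case
    by (rule exI[of _ "\<lambda>_. c 0"], rule exI[of _ "\<lambda>_. - c 1"]) simp
next
  case (Suc n)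
  have "\<exists>u v d. \<forall>x y. (\<Sum>i\<le>Suc n. c i * x ^ (Suc n - i) * y ^ i) =
          (u * x - v * y) * (\<Sum>i\<le>n. d i * x ^ (n - i) * y ^ i)"
  proof (cases "c 0 = 0")
    case True
    have "(\<Sum>i\<le>Suc n. c i * x ^ (Suc n - i) * y ^ i) =
            (0 * x - (-1) * y) * (\<Sum>i\<le>n. c (Suc i) * x ^ (n - i) * y ^ i)" for x y
      using True by (subst sum.atMost_Suc_shift) (simp add: sum_distrib_left mult_ac)
    then show ?thesis
      by (intro exI[of _ 0] exI[of _ "-1"] exI[of _ "\<lambda>i. c (Suc i)"]) blast
  next
    case False
    define p where "p = (\<Sum>i\<le>Suc n. monom (c i) (Suc n - i))"
    have "coeff p (Suc n) = (\<Sum>i\<le>Suc n. if i = 0 then c i else 0)"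
      unfolding p_def coeff_sum by (intro sum.cong) auto
    also have "\<dots> = c 0"
      by (subst sum.delta) auto
    finally have "coeff p (Suc n) \<noteq> 0"
      using False by simp
    then have "\<not> (\<exists>a l. a \<noteq> 0 \<and> l = 0 \<and> p = pCons a l)"
      by auto
    then obtain z where z: "poly p z = 0"
      using fundamental_theorem_of_algebra_alt by blast
    define b where "b i = (\<Sum>k\<le>i. c k * z ^ (i - k))" for i
    have b0: "b 0 = c 0"
      by (simp add: b_def)
    have bS: "b (Suc i) = c (Suc i) + z * b i" for i
      by (auto simp: b_def sum_distrib_left Suc_diff_le mult_ac intro!: sum.cong)
    have bn: "b (Suc n) = 0"
      using z by (simp add: p_def b_def poly_sum poly_monom)
    have "(\<Sum>i\<le>Suc n. c i * x ^ (Suc n - i) * y ^ i) =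
            (1 * x - z * y) * (\<Sum>i\<le>n. b i * x ^ (n - i) * y ^ i)" for x y
    proof -
      have "(\<Sum>i\<le>Suc n. c i * x ^ (Suc n - i) * y ^ i) =
              c 0 * x ^ Suc n + (\<Sum>i\<le>n. c (Suc i) * x ^ (n - i) * y ^ Suc i)"
        by (subst sum.atMost_Suc_shift) simp
      also have "\<dots> = b 0 * x ^ Suc n + (\<Sum>i\<le>n. b (Suc i) * x ^ (n - i) * y ^ Suc i) -
              z * y * (\<Sum>i\<le>n. b i * x ^ (n - i) * y ^ i)"
        by (simp add: b0 bS algebra_simps sum.distrib sum_distrib_left)
      also have "b 0 * x ^ Suc n + (\<Sum>i\<le>n. b (Suc i) * x ^ (n - i) * y ^ Suc i) =
              (\<Sum>i\<le>Suc n. b i * x ^ (Suc n - i) * y ^ i)"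
        by (subst sum.atMost_Suc_shift) simp
      also have "\<dots> = x * (\<Sum>i\<le>n. b i * x ^ (n - i) * y ^ i)"
        by (simp add: bn sum_distrib_left Suc_diff_le mult_ac)
      finally show ?thesis
        by (simp add: algebra_simps)
    qed
    then show ?thesis
      by blast
  qed
  then obtain u v d where uv: "\<And>x y. (\<Sum>i\<le>Suc n. c i * x ^ (Suc n - i) * y ^ i) =
      (u * x - v * y) * (\<Sum>i\<le>n. d i * x ^ (n - i) * y ^ i)"
    by blast
  obtain \<alpha> \<beta> where ab: "\<And>x y. (\<Sum>i\<le>n. d i * x ^ (n - i) * y ^ i) = (\<Prod>i<n. \<alpha> i * x - \<beta> i * y)"
    using Suc.IH by blast
  have "(\<Sum>i\<le>Suc n. c i * x ^ (Suc n - i) * y ^ i) =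
          (\<Prod>i<Suc n. (\<alpha>(n := u)) i * x - (\<beta>(n := v)) i * y)" for x y
    by (simp only: uv ab prod.lessThan_Suc) simp
  then show ?case
    by blast
qed

lemma linear_factorization_exists:
  assumes "n \<ge> 1"
  shows "\<exists>\<alpha> \<beta>. linear_factorization n a \<alpha> \<beta>"
  using complex_form_factorization[OF assms, of "\<lambda>i. of_int (a i)"]
  by (simp add: linear_factorization_def eval_form_def)


subsection \<open>Independence of the factorization\<close>

text \<open>
  Up to sign, the product over \<open>i < j\<close> of the squares is the product over all ordered
  pairs \<open>i \<noteq> j\<close>; the latter does not depend on an ordering of the factors.
\<close>

definition ordered_disc :: "nat set \<Rightarrow> (nat \<Rightarrow> complex) \<Rightarrow> (nat \<Rightarrow> complex) \<Rightarrow> complex" where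
  "ordered_disc A \<alpha> \<beta> = (\<Prod>j\<in>A. \<Prod>i\<in>A - {j}. \<alpha> i * \<beta> j - \<alpha> j * \<beta> i)"

lemma ordered_disc_insert:
  assumes "finite A" "k \<notin> A"
  shows "ordered_disc (insert k A) \<alpha> \<beta> =
    (-1) ^ card A * ordered_disc A \<alpha> \<beta> * (\<Prod>i\<in>A. \<alpha> i * \<beta> k - \<alpha> k * \<beta> i)\<^sup>2"
proof -
  have 1: "(\<Prod>i\<in>insert k A - {j}. \<alpha> i * \<beta> j - \<alpha> j * \<beta> i) =
      (-1) * (\<alpha> j * \<beta> k - \<alpha> k * \<beta> j) * (\<Prod>i\<in>A - {j}. \<alpha> i * \<beta> j - \<alpha> j * \<beta> i)" if "j \<in> A" for j
  proof -
    have "insert k A - {j} = insert k (A - {j})"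
      using that assms by auto
    then show ?thesis
      using assms by (simp add: algebra_simps)
  qed
  have "insert k A - {k} = A"
    using assms by auto
  then have "ordered_disc (insert k A) \<alpha> \<beta> = (\<Prod>i\<in>A. \<alpha> i * \<beta> k - \<alpha> k * \<beta> i) *
      (\<Prod>j\<in>A. (-1) * (\<alpha> j * \<beta> k - \<alpha> k * \<beta> j) * (\<Prod>i\<in>A - {j}. \<alpha> i * \<beta> j - \<alpha> j * \<beta> i))"
    unfolding ordered_disc_def prod.insert[OF assms]
    by (intro arg_cong2[where f = "(*)"] prod.cong 1) auto
  also have "\<dots> = (-1) ^ card A * ordered_disc A \<alpha> \<beta> * (\<Prod>i\<in>A. \<alpha> i * \<beta> k - \<alpha> k * \<beta> i)\<^sup>2"
    by (simp only: prod.distrib prod_constant ordered_disc_def power2_eq_square mult_ac)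
  finally show ?thesis .
qed

lemma ordered_disc_eq:
  "ordered_disc {..<n} \<alpha> \<beta> = (-1) ^ (\<Sum>j<n. j) * disc_of_factors n \<alpha> \<beta>"
proof (induction n)
  case 0
  show ?case by (simp add: ordered_disc_def disc_of_factors_def)
next
  case (Suc n)
  show ?case
    by (simp add: lessThan_Suc ordered_disc_insert Suc.IH disc_of_factors_def prod_power_distrib
        power_add mult_ac)
qed

lemma ordered_disc_zero_factor:
  assumes "finite A" "card A \<ge> 2" "k \<in> A" "\<alpha> k = 0" "\<beta> k = 0"
  shows "ordered_disc A \<alpha> \<beta> = 0"
proof -
  have A: "A = insert k (A - {k})"
    using assms by auto
  have "card (A - {k}) \<ge> 1"
    using assms by simp
  then have "A - {k} \<noteq> {}"
    by force
  then have "(\<Prod>i\<in>A - {k}. \<alpha> i * \<beta> k - \<alpha> k * \<beta> i) = 0"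
    using assms by (simp add: prod_zero_iff ex_in_conv)
  then show ?thesis
    using assms by (subst A, subst ordered_disc_insert) auto
qed

lemma prod_linear_zero:
  fixes \<alpha> \<beta> :: "nat \<Rightarrow> complex"
  assumes "finite A" "\<And>x y. (\<Prod>i\<in>A. \<alpha> i * x - \<beta> i * y) = 0"
  shows "\<exists>k\<in>A. \<alpha> k = 0 \<and> \<beta> k = 0"
proof (rule ccontr)
  assume no: "\<not> ?thesis"
  have "t \<in> (\<lambda>i. \<alpha> i / \<beta> i) ` A" for t :: complex
  proof -
    have "(\<Prod>i\<in>A. \<alpha> i * 1 - \<beta> i * t) = 0"
      using assms(2) by blast
    then obtain i where i: "i \<in> A" "\<alpha> i = \<beta> i * t"
      using assms(1) by auto
    with no have "\<beta> i \<noteq> 0"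
      by auto
    with i show ?thesis
      by (auto simp: field_simps intro!: image_eqI[of _ _ i])
  qed
  then have "(UNIV :: complex set) \<subseteq> (\<lambda>i. \<alpha> i / \<beta> i) ` A"
    by blast
  with assms(1) show False
    using finite_subset infinite_UNIV_char_0 by blast
qed

lemma cancel_linear_factor:
  fixes u v :: complex and f :: "complex \<Rightarrow> complex \<Rightarrow> complex"
  assumes uv: "u \<noteq> 0 \<or> v \<noteq> 0"
    and cont: "\<And>x y p q. continuous_on UNIV (\<lambda>t. f (x + t * p) (y + t * q))"
    and zero: "\<And>x y. (u * x - v * y) * f x y = 0"
  shows "f x y = 0"
proof (cases "u * x - v * y = 0")
  case False
  then show ?thesis using zero[of x y] by simp
next
  case True
  define p where "p = (if u \<noteq> 0 then 1 else 0 :: complex)"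
  define q where "q = (if u \<noteq> 0 then 0 else 1 :: complex)"
  have pq: "u * p - v * q \<noteq> 0"
    using uv by (auto simp: p_def q_def)
  let ?g = "\<lambda>t. f (x + t * p) (y + t * q)"
  have "?g t = 0" if "t \<noteq> 0" for t
  proof -
    have "u * (x + t * p) - v * (y + t * q) = t * (u * p - v * q)"
      using True by (simp add: algebra_simps)
    then show ?thesis
      using zero[of "x + t * p" "y + t * q"] pq that by simp
  qed
  moreover have "isCont ?g 0"
    using cont continuous_on_eq_continuous_at[of UNIV ?g] by simp
  then have "?g \<midarrow>0\<rightarrow> ?g 0"
    unfolding isCont_def .
  ultimately have "(\<lambda>_::complex. 0) \<midarrow>0\<rightarrow> ?g 0"
    by (subst (asm) LIM_equal[of 0 ?g "\<lambda>_. 0"]) auto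
  then show ?thesis
    using LIM_const_eq[of 0 "?g 0" "0::complex"] by simp
qed

lemma ordered_disc_scale:
  assumes "finite A" "finite B" "card A = n" "card B = n"
    and "\<And>x y. (\<Prod>i\<in>A. \<alpha> i * x - \<beta> i * y) = c * (\<Prod>i\<in>B. \<gamma> i * x - \<delta> i * y)"
  shows "ordered_disc A \<alpha> \<beta> = c ^ (2 * (n - 1)) * ordered_disc B \<gamma> \<delta>"
  using assms
proof (induction n arbitrary: A B c)
  case 0
  then show ?case by (simp add: ordered_disc_def)
next
  case (Suc n)
  show ?case
  proof (cases "n = 0")
    case True
    with Suc.prems obtain k l where "A = {k}" "B = {l}"
      by (auto simp: card_1_singleton_iff)
    with True show ?thesis by (simp add: ordered_disc_def)
  next
    case n: False
    show ?thesis
    proof (cases "c = 0 \<or> (\<exists>k\<in>A. \<alpha> k = 0 \<and> \<beta> k = 0)")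
      case True
      have A0: "(\<Prod>i\<in>A. \<alpha> i * x - \<beta> i * y) = 0" for x y
      proof (cases "c = 0")
        case True
        then show ?thesis using Suc.prems(5)[of x y] by simp
      next
        case False
        then have "\<exists>k\<in>A. \<alpha> k * x - \<beta> k * y = 0"
          using True by force
        then show ?thesis using Suc.prems(1) by (simp add: prod_zero)
      qed
      obtain k where "k \<in> A" "\<alpha> k = 0" "\<beta> k = 0"
        using prod_linear_zero[OF Suc.prems(1) A0] by auto
      then have DA: "ordered_disc A \<alpha> \<beta> = 0"
        using Suc.prems n by (intro ordered_disc_zero_factor) auto
      show ?thesis
      proof (cases "c = 0")
        case True
        with DA n show ?thesis by simp
      next
        case False
        then have "(\<Prod>i\<in>B. \<gamma> i * x - \<delta> i * y) = 0" for x y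
          using A0 Suc.prems(5)[of x y] by simp
        then obtain l where "l \<in> B" "\<gamma> l = 0" "\<delta> l = 0"
          using prod_linear_zero[OF Suc.prems(2)] by blast
        then have "ordered_disc B \<gamma> \<delta> = 0"
          using Suc.prems n by (intro ordered_disc_zero_factor) auto
        with DA show ?thesis by simp
      qed
    next
      case False
      then have c: "c \<noteq> 0"
        by blast
      obtain k where k: "k \<in> A"
        using Suc.prems by fastforce
      with False have kk: "\<alpha> k \<noteq> 0 \<or> \<beta> k \<noteq> 0"
        by blast
      have "(\<Prod>i\<in>A. \<alpha> i * \<beta> k - \<beta> i * \<alpha> k) = 0"
        using k Suc.prems(1) by (intro prod_zero) (auto intro!: bexI[of _ k] simp: mult.commute)
      then have "(\<Prod>i\<in>B. \<gamma> i * \<beta> k - \<delta> i * \<alpha> k) = 0"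
        using c Suc.prems(5)[of "\<beta> k" "\<alpha> k"] by simp
      then obtain l where l: "l \<in> B" "\<gamma> l * \<beta> k = \<delta> l * \<alpha> k"
        using Suc.prems(2) by auto
      define s where "s = (if \<alpha> k \<noteq> 0 then \<gamma> l / \<alpha> k else \<delta> l / \<beta> k)"
      have s: "\<gamma> l = s * \<alpha> k" "\<delta> l = s * \<beta> k"
        using kk l(2) by (auto simp: s_def field_simps)
      define A' where "A' = A - {k}"
      define B' where "B' = B - {l}"
      have A': "A = insert k A'" "k \<notin> A'" "finite A'" "card A' = n"
        using k Suc.prems by (auto simp: A'_def)
      have B': "B = insert l B'" "l \<notin> B'" "finite B'" "card B' = n"
        using l Suc.prems by (auto simp: B'_def)
      define f where "f x y = (\<Prod>i\<in>A'. \<alpha> i * x - \<beta> i * y) -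
        c * s * (\<Prod>i\<in>B'. \<gamma> i * x - \<delta> i * y)" for x y
      have "f x y = 0" for x y
      proof (rule cancel_linear_factor[where f = f, OF kk])
        show "continuous_on UNIV (\<lambda>t. f (x + t * p) (y + t * q))" for x y p q
          unfolding f_def by (intro continuous_intros)
        show "(\<alpha> k * x - \<beta> k * y) * f x y = 0" for x y
          using Suc.prems(5)[of x y] A' B' by (simp add: f_def s algebra_simps)
      qed
      then have eq: "(\<Prod>i\<in>A'. \<alpha> i * x - \<beta> i * y) = (c * s) * (\<Prod>i\<in>B'. \<gamma> i * x - \<delta> i * y)" for x y
        by (simp add: f_def)
      have IH: "ordered_disc A' \<alpha> \<beta> = (c * s) ^ (2 * (n - 1)) * ordered_disc B' \<gamma> \<delta>"
        using A' B' eq by (intro Suc.IH) auto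
      define P where "P = (\<Prod>i\<in>B'. \<gamma> i * \<beta> k - \<delta> i * \<alpha> k)"
      have "(\<Prod>i\<in>A'. \<alpha> i * \<beta> k - \<alpha> k * \<beta> i) = c * s * P"
        using eq[of "\<beta> k" "\<alpha> k"] by (simp add: P_def mult.commute)
      then have DA: "ordered_disc A \<alpha> \<beta> =
          (-1) ^ n * ((c * s) ^ (2 * (n - 1)) * ordered_disc B' \<gamma> \<delta>) * (c * s * P)\<^sup>2"
        using A' by (simp add: ordered_disc_insert IH)
      have "(\<Prod>i\<in>B'. \<gamma> i * \<delta> l - \<gamma> l * \<delta> i) = (\<Prod>i\<in>B'. s * (\<gamma> i * \<beta> k - \<delta> i * \<alpha> k))"
        by (intro prod.cong) (auto simp: s algebra_simps)
      also have "\<dots> = s ^ n * P"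
        using B' by (simp add: prod.distrib P_def)
      finally have DB: "ordered_disc B \<gamma> \<delta> = (-1) ^ n * ordered_disc B' \<gamma> \<delta> * (s ^ n * P)\<^sup>2"
        using B' by (simp add: ordered_disc_insert)
      obtain m where "n = Suc m"
        using n not0_implies_Suc by blast
      then show ?thesis
        by (simp add: DA DB power_mult_distrib mult_ac power2_eq_square mult_2_right
            power_add)
    qed
  qed
qed

lemma disc_of_factors_unique:
  assumes "linear_factorization n a \<alpha> \<beta>" "linear_factorization n a \<gamma> \<delta>"
  shows "disc_of_factors n \<alpha> \<beta> = disc_of_factors n \<gamma> \<delta>"
proof -
  have "ordered_disc {..<n} \<alpha> \<beta> = 1 ^ (2 * (n - 1)) * ordered_disc {..<n} \<gamma> \<delta>"
    using assms by (intro ordered_disc_scale) (auto simp: linear_factorization_def)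
  then show ?thesis
    by (simp add: ordered_disc_eq)
qed

lemma form_disc_eq:
  assumes "linear_factorization n a \<alpha> \<beta>"
  shows "form_disc n a = disc_of_factors n \<alpha> \<beta>"
  unfolding form_disc_def using assms disc_of_factors_unique by blast

end

theory Submission
  imports Defs "HOL-Complex_Analysis.Cauchy_Integral_Formula" "Jordan_Normal_Form.Char_Poly"
begin

text \<open>
  In the coordinate \<open>t = x / y\<close> the area is the integral of \<open>\<bar>F(t,1)\<bar>\<close> to the power \<open>-2/n\<close>, where \<open>F\<close> is
  the product of linear forms \<open>l\<^sub>i\<close>. As \<open>F\<close> has integer coefficients, \<open>\<bar>D\<^sub>F\<bar> \<ge> 1\<close>, so it suffices to bound
  \<open>\<bar>D\<^sub>F\<bar>\<close> to the power \<open>1/(n(n-1))\<close> times this integral, for arbitrary complex factors \<open>l\<^sub>i\<close>. By the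
  inequality of arithmetic and geometric means over all triples of factors the case \<open>n = 3\<close> is enough.
  There, as a function of a single factor \<open>l\<^sub>1\<close>, the integrand is at most its average over the real forms
  \<open>Re (exp (-\<pi> i s) l\<^sub>1)\<close>; this is the mean value property of a function holomorphic in the unit disc. Replacing
  the factors by real ones in turn leaves the case of three real factors, in which a linear map carries the
  form to \<open>X Y (X - Y)\<close> and equality holds.
\<close>

section \<open>Areas of homogeneous regions\<close>

text \<open>The power of the discriminant is chosen so that its product with the area is unchanged
  when a factor is scaled and when the variables undergo a real linear map. As XY(X - Y) has
  discriminant 1, the sharp constant is its area. For the averaging put w = exp(2 pi i s). Up to a
  constant of modulus 1 the real form is half of l_1 + w conj(l_1), where conj acts on the
  coefficients. Its value at t and its determinants against l_2 and l_3 are therefore affine in w,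
  and w = 0 gives back l_1/2. The mean value property needs a holomorphic branch of a product of
  powers 1/3, 1/3, -2/3 of these affine functions. As t is real, the one with the negative power
  vanishes on the unit circle and not inside; that singularity is integrable since 2/3 < 1. A
  determinant may vanish inside the disc, which reflection in the circle repairs. The bound on the
  discriminant is not immediate, since the factors are merely complex: its modulus is obtained as
  that of the determinant of an integer matrix \<open>Q^T Q\<close>.\<close>

lemma nn_integral_linear_image_nonzero:
  fixes f :: "real \<times> real \<Rightarrow> ennreal"
  assumes f [measurable]: "f \<in> borel_measurable borel"
    and a: "a \<noteq> 0" and D: "a * d - b * c \<noteq> 0"
  shows "(\<integral>\<^sup>+y. \<integral>\<^sup>+x. f (x, y) \<partial>lborel \<partial>lborel) =
    ennreal \<bar>a * d - b * c\<bar> * (\<integral>\<^sup>+y. \<integral>\<^sup>+x. f (a * x + b * y, c * x + d * y) \<partial>lborel \<partial>lborel)"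
proof -
  let ?D = "a * d - b * c"
  have [measurable]: "f \<in> borel_measurable (borel \<Otimes>\<^sub>M borel)"
    using f by (simp add: borel_prod)
  have "(\<integral>\<^sup>+y. \<integral>\<^sup>+x. f (a * x + b * y, c * x + d * y) \<partial>lborel \<partial>lborel) =
    (\<integral>\<^sup>+y. ennreal \<bar>1 / a\<bar> * (\<integral>\<^sup>+u. f (u, c / a * u + ?D / a * y) \<partial>lborel) \<partial>lborel)"
  proof (intro nn_integral_cong)
    fix y :: real
    \<comment> \<open>The matrix is split into two one-dimensional affine substitutions: u = a x + b
      y at fixed y, then, after Tonelli, one in y at fixed u. The first needs a nonzero
      \<open>a\<close>.\<close>
    have *: "a * (- (b * y) / a + 1 / a * u) + b * y = u"
       "c * (- (b * y) / a + 1 / a * u) + d * y = c / a * u + ?D / a * y" for u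
      using a by (auto simp: field_simps)
    show "(\<integral>\<^sup>+x. f (a * x + b * y, c * x + d * y) \<partial>lborel) =
      ennreal \<bar>1 / a\<bar> * (\<integral>\<^sup>+u. f (u, c / a * u + ?D / a * y) \<partial>lborel)"
      using a by (subst nn_integral_real_affine[where c = "1 / a" and t = "- (b * y) / a"]) (unfold *, auto)
  qed
  also have "\<dots> = ennreal \<bar>1 / a\<bar> * (\<integral>\<^sup>+y. \<integral>\<^sup>+u. f (u, c / a * u + ?D / a * y) \<partial>lborel \<partial>lborel)"
    by (rule nn_integral_cmult) measurable
  also have "(\<integral>\<^sup>+y. \<integral>\<^sup>+u. f (u, c / a * u + ?D / a * y) \<partial>lborel \<partial>lborel) =
      (\<integral>\<^sup>+u. \<integral>\<^sup>+y. f (u, c / a * u + ?D / a * y) \<partial>lborel \<partial>lborel)"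
    by (rule lborel_pair.Fubini') measurable
  finally have "ennreal \<bar>?D\<bar> * (\<integral>\<^sup>+y. \<integral>\<^sup>+x. f (a * x + b * y, c * x + d * y) \<partial>lborel \<partial>lborel) =
      ennreal \<bar>?D / a\<bar> * (\<integral>\<^sup>+u. \<integral>\<^sup>+y. f (u, c / a * u + ?D / a * y) \<partial>lborel \<partial>lborel)"
    by (simp only:) (unfold mult.assoc[symmetric], subst ennreal_mult[symmetric], auto)
  also have "\<dots> = (\<integral>\<^sup>+u. ennreal \<bar>?D / a\<bar> * (\<integral>\<^sup>+y. f (u, c / a * u + ?D / a * y) \<partial>lborel) \<partial>lborel)"
    by (rule nn_integral_cmult[symmetric]) measurable
  also have "\<dots> = (\<integral>\<^sup>+u. \<integral>\<^sup>+v. f (u, v) \<partial>lborel \<partial>lborel)"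
    using a D by (intro nn_integral_cong nn_integral_real_affine[symmetric]) auto
  also have "\<dots> = (\<integral>\<^sup>+v. \<integral>\<^sup>+u. f (u, v) \<partial>lborel \<partial>lborel)"
    by (rule lborel_pair.Fubini'[symmetric]) measurable
  finally show ?thesis ..
qed

text \<open>If \<open>a = 0\<close> then \<open>c\<close> is nonzero, and exchanging the two
  arguments of \<open>f\<close> exchanges the rows of the matrix.\<close>

lemma nn_integral_linear_image:
  fixes f :: "real \<times> real \<Rightarrow> ennreal"
  assumes f [measurable]: "f \<in> borel_measurable borel"
    and D: "a * d - b * c \<noteq> 0"
  shows "(\<integral>\<^sup>+y. \<integral>\<^sup>+x. f (x, y) \<partial>lborel \<partial>lborel) =
    ennreal \<bar>a * d - b * c\<bar> * (\<integral>\<^sup>+y. \<integral>\<^sup>+x. f (a * x + b * y, c * x + d * y) \<partial>lborel \<partial>lborel)"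
proof (cases "a = 0")
  case False
  show ?thesis
    using nn_integral_linear_image_nonzero[OF f False D] .
next
  case True
  have [measurable]: "f \<in> borel_measurable (borel \<Otimes>\<^sub>M borel)"
    using f by (simp add: borel_prod)
  have f': "(\<lambda>(x, y). f (y, x)) \<in> borel_measurable borel"
    unfolding borel_prod[symmetric] by measurable
  have c: "c \<noteq> 0" and "c * b - d * a \<noteq> 0"
    using D True by auto
  have "(\<integral>\<^sup>+y. \<integral>\<^sup>+x. f (x, y) \<partial>lborel \<partial>lborel) = (\<integral>\<^sup>+x. \<integral>\<^sup>+y. f (x, y) \<partial>lborel \<partial>lborel)"
    by (rule lborel_pair.Fubini') measurable
  also have "\<dots> = ennreal \<bar>c * b - d * a\<bar> * (\<integral>\<^sup>+y. \<integral>\<^sup>+x. f (a * x + b * y, c * x + d * y) \<partial>lborel \<partial>lborel)"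
    using nn_integral_linear_image_nonzero[OF f' c \<open>c * b - d * a \<noteq> 0\<close>] by simp
  finally show ?thesis using True by (simp add: abs_mult mult.commute)
qed

lemma emeasure_lborel_plane:
  fixes P :: "real \<times> real \<Rightarrow> bool"
  assumes P [measurable]: "Measurable.pred borel P"
  shows "emeasure lborel {z. P z} = (\<integral>\<^sup>+y. \<integral>\<^sup>+x. indicator {z. P z} (x, y) \<partial>lborel \<partial>lborel)"
proof -
  have "{z. P z} \<in> sets borel"
    by measurable
  then have S: "{z. P z} \<in> sets (lborel \<Otimes>\<^sub>M lborel)"
    unfolding lborel_prod by simp
  have "emeasure lborel {z. P z} = (\<integral>\<^sup>+z. indicator {z. P z} z \<partial>(lborel \<Otimes>\<^sub>M lborel))"
    using S by (subst nn_integral_indicator) (auto simp: lborel_prod)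
  also have "\<dots> = (\<integral>\<^sup>+y. \<integral>\<^sup>+x. indicator {z. P z} (x, y) \<partial>lborel \<partial>lborel)"
    using S by (subst lborel_pair.nn_integral_snd[symmetric]) auto
  finally show ?thesis
    by (simp add: indicator_def case_prod_unfold)
qed

lemma emeasure_linear_image:
  fixes P :: "real \<times> real \<Rightarrow> bool"
  assumes P [measurable]: "Measurable.pred borel P" and D: "a * d - b * c \<noteq> 0"
  shows "emeasure lborel {z. P z} =
    ennreal \<bar>a * d - b * c\<bar> * emeasure lborel {(x, y). P (a * x + b * y, c * x + d * y)}"
proof -
  have P' [measurable]: "Measurable.pred (borel \<Otimes>\<^sub>M borel) P"
    using P unfolding borel_prod .
  have *: "Measurable.pred borel (\<lambda>(x, y). P (a * x + b * y, c * x + d * y))"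
    unfolding borel_prod[symmetric] by measurable
  have **: "(indicator {z. P z} :: _ \<Rightarrow> ennreal) \<in> borel_measurable borel"
    by measurable
  show ?thesis
    using nn_integral_linear_image[OF ** D]
    unfolding emeasure_lborel_plane[OF P] emeasure_lborel_plane[OF *] by (simp add: indicator_def case_prod_unfold)
qed

text \<open>Substituting \<open>x = t y\<close> turns the area of a truncated cone into an integral over the line \<open>y = 1\<close>.\<close>

lemma emeasure_homogeneous_cone:
  fixes F :: "real \<times> real \<Rightarrow> real"
  assumes F [measurable]: "F \<in> borel_measurable borel"
    and S [measurable]: "S \<in> sets borel"
    and hom: "\<And>c x y. \<bar>F (c * x, c * y)\<bar> = \<bar>c\<bar> ^ n * \<bar>F (x, y)\<bar>"
    and nz: "AE t in lborel. F (t, 1) \<noteq> 0" and n: "n > 0"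
  shows "emeasure lborel {(x, y). y \<noteq> 0 \<and> x / y \<in> S \<and> \<bar>F (x, y)\<bar> \<le> 1} =
    (\<integral>\<^sup>+t. ennreal (\<bar>F (t, 1)\<bar> powr (- 2 / real n)) * indicator S t \<partial>lborel)"
proof -
  have F' [measurable]: "F \<in> borel_measurable (borel \<Otimes>\<^sub>M borel)"
    using F unfolding borel_prod .
  have P: "Measurable.pred borel (\<lambda>(x, y). y \<noteq> 0 \<and> x / y \<in> S \<and> \<bar>F (x, y)\<bar> \<le> 1)"
    unfolding borel_prod[symmetric] by measurable
  \<comment> \<open>The factor |y| is the Jacobian of x = t y, and homogeneity gives |F(t y, y)| =
    |y|^n |F(t, 1)|.\<close>
  let ?g = "\<lambda>t y. ennreal \<bar>y\<bar> * indicator {(t, y). t \<in> S \<and> \<bar>y\<bar> ^ n * \<bar>F (t, 1)\<bar> \<le> 1} (t, y)"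
  have g [measurable]: "case_prod ?g \<in> borel_measurable (borel \<Otimes>\<^sub>M borel)"
    unfolding indicator_def by measurable
  have "emeasure lborel {(x, y). y \<noteq> 0 \<and> x / y \<in> S \<and> \<bar>F (x, y)\<bar> \<le> 1} =
    (\<integral>\<^sup>+y. \<integral>\<^sup>+x. indicator {z. z \<noteq> 0 \<and> x / z \<in> S \<and> \<bar>F (x, z)\<bar> \<le> 1} y \<partial>lborel \<partial>lborel)"
    using emeasure_lborel_plane[OF P] by (simp add: indicator_def)
  also have "\<dots> = (\<integral>\<^sup>+y. \<integral>\<^sup>+t. ?g t y \<partial>lborel \<partial>lborel)"
  proof (rule nn_integral_cong)
    fix y :: real
    show "(\<integral>\<^sup>+x. indicator {z. z \<noteq> 0 \<and> x / z \<in> S \<and> \<bar>F (x, z)\<bar> \<le> 1} y \<partial>lborel) = (\<integral>\<^sup>+t. ?g t y \<partial>lborel)"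
    proof (cases "y = 0")
      case False
      have "(\<integral>\<^sup>+x. indicator {z. z \<noteq> 0 \<and> x / z \<in> S \<and> \<bar>F (x, z)\<bar> \<le> 1} y \<partial>lborel) =
        ennreal \<bar>y\<bar> * (\<integral>\<^sup>+t. indicator {z. z \<noteq> 0 \<and> (y * t) / z \<in> S \<and> \<bar>F (y * t, z)\<bar> \<le> 1} y \<partial>lborel)"
        using False unfolding indicator_def by (subst nn_integral_real_affine[where c = y and t = 0]) auto
      also have "\<dots> = ennreal \<bar>y\<bar> * (\<integral>\<^sup>+t. indicator {(t, y). t \<in> S \<and> \<bar>y\<bar> ^ n * \<bar>F (t, 1)\<bar> \<le> 1} (t, y) \<partial>lborel)"
        using False hom[of y _ 1] by (intro arg_cong2[where f = "(*)"] nn_integral_cong) (auto simp: indicator_def)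
      also have "\<dots> = (\<integral>\<^sup>+t. ?g t y \<partial>lborel)"
        unfolding indicator_def mem_Collect_eq case_prod_conv by (rule nn_integral_cmult[symmetric]) measurable
      finally show ?thesis .
    qed auto
  qed
  also have "\<dots> = (\<integral>\<^sup>+t. \<integral>\<^sup>+y. ?g t y \<partial>lborel \<partial>lborel)"
    by (rule lborel_pair.Fubini') measurable
  also have "\<dots> = (\<integral>\<^sup>+t. ennreal (\<bar>F (t, 1)\<bar> powr (- 2 / real n)) * indicator S t \<partial>lborel)"
  proof (rule nn_integral_cong_AE, use nz in eventually_elim)
    case (elim t)
    \<comment> \<open>For fixed t the admissible y form the interval [-R, R], over which |y| has
      integral R^2. This is the origin of the exponent -2/n.\<close>
    define R where "R = \<bar>F (t, 1)\<bar> powr (- 1 / real n)"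
    have R: "R > 0" "R\<^sup>2 = \<bar>F (t, 1)\<bar> powr (- 2 / real n)"
      using elim by (auto simp: R_def powr_power)
    have "R ^ n = \<bar>F (t, 1)\<bar> powr (- 1 / real n * real n)"
      unfolding R_def using elim by (subst powr_power) auto
    then have Rn: "R ^ n * \<bar>F (t, 1)\<bar> = 1"
      using elim n by (simp add: powr_minus)
    have le: "\<bar>y\<bar> ^ n * \<bar>F (t, 1)\<bar> \<le> 1 \<longleftrightarrow> \<bar>y\<bar> \<le> R" for y
    proof -
      have "\<bar>y\<bar> ^ n * \<bar>F (t, 1)\<bar> \<le> 1 \<longleftrightarrow> \<bar>y\<bar> ^ n * \<bar>F (t, 1)\<bar> \<le> R ^ n * \<bar>F (t, 1)\<bar>"
        using Rn by simp
      also have "\<dots> \<longleftrightarrow> \<bar>y\<bar> ^ n \<le> R ^ n"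
        using elim by simp
      also have "\<dots> \<longleftrightarrow> \<bar>y\<bar> \<le> R"
        using R n by (simp add: power_mono_iff)
      finally show ?thesis .
    qed
    have "((\<lambda>y. \<bar>y\<bar>) has_integral (0 - (- (R\<^sup>2 / 2)))) {-R..0}"
    proof (rule fundamental_theorem_of_calculus[where f = "\<lambda>y. - (y\<^sup>2 / 2)", THEN has_integral_eq_rhs])
      show "((\<lambda>y. - (y\<^sup>2 / 2)) has_vector_derivative \<bar>x\<bar>) (at x within {- R..0})" if "x \<in> {- R..0}" for x
        using that by (auto intro!: derivative_eq_intros simp: has_real_derivative_iff_has_vector_derivative[symmetric])
    qed (use R in auto)
    moreover have "((\<lambda>y. \<bar>y\<bar>) has_integral (R\<^sup>2 / 2 - 0)) {0..R}"
    proof (rule fundamental_theorem_of_calculus[where f = "\<lambda>y. (y\<^sup>2 / 2)", THEN has_integral_eq_rhs])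
      show "((\<lambda>y. (y\<^sup>2 / 2)) has_vector_derivative \<bar>x\<bar>) (at x within {0..R})" if "x \<in> {0..R}" for x
        using that by (auto intro!: derivative_eq_intros simp: has_real_derivative_iff_has_vector_derivative[symmetric])
    qed (use R in auto)
    ultimately have "((\<lambda>y. \<bar>y\<bar>) has_integral R\<^sup>2) {-R..R}"
      using R has_integral_combine[of "-R" 0 R "\<lambda>y. \<bar>y\<bar>"] by fastforce
    then have 1: "(\<integral>\<^sup>+y. ennreal (indicator {-R..R} y * \<bar>y\<bar>) \<partial>lborel) = ennreal (R\<^sup>2)"
      by (intro nn_integral_has_integral_lebesgue) auto
    have "(\<integral>\<^sup>+y. ?g t y \<partial>lborel) = (\<integral>\<^sup>+y. ennreal (indicator {-R..R} y * \<bar>y\<bar>) * indicator S t \<partial>lborel)"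
      by (intro nn_integral_cong) (auto simp: le indicator_def)
    also have "\<dots> = ennreal (R\<^sup>2) * indicator S t"
      using 1 by (subst nn_integral_multc) (auto)
    finally show ?case using R by simp
  qed
  finally show ?thesis .
qed

lemma emeasure_homogeneous_region:
  fixes F :: "real \<times> real \<Rightarrow> real"
  assumes F [measurable]: "F \<in> borel_measurable borel"
    and hom: "\<And>c x y. \<bar>F (c * x, c * y)\<bar> = \<bar>c\<bar> ^ n * \<bar>F (x, y)\<bar>"
    and nz: "AE t in lborel. F (t, 1) \<noteq> 0" and n: "n > 0"
  shows "emeasure lborel {z. \<bar>F z\<bar> \<le> 1} = (\<integral>\<^sup>+t. ennreal (\<bar>F (t, 1)\<bar> powr (- 2 / real n)) \<partial>lborel)"
proof -
  have F' [measurable]: "F \<in> borel_measurable (borel \<Otimes>\<^sub>M borel)"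
    using F unfolding borel_prod .
  have P: "Measurable.pred borel (\<lambda>z. \<bar>F z\<bar> \<le> 1)"
    by measurable
  have P': "Measurable.pred borel (\<lambda>(x, y). y \<noteq> 0 \<and> x / y \<in> UNIV \<and> \<bar>F (x, y)\<bar> \<le> 1)"
    unfolding borel_prod[symmetric] by measurable
  have "emeasure lborel {z. \<bar>F z\<bar> \<le> 1} = emeasure lborel {(x, y). y \<noteq> 0 \<and> x / y \<in> UNIV \<and> \<bar>F (x, y)\<bar> \<le> 1}"
    unfolding emeasure_lborel_plane[OF P] emeasure_lborel_plane[OF P']
    by (rule nn_integral_cong_AE, rule eventually_mono[OF AE_lborel_singleton[of 0]]) (simp add: indicator_def)
  also have "\<dots> = (\<integral>\<^sup>+t. ennreal (\<bar>F (t, 1)\<bar> powr (- 2 / real n)) \<partial>lborel)"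
    by (subst emeasure_homogeneous_cone[OF F _ hom nz n]) auto
  finally show ?thesis .
qed

section \<open>The extremal form and products of three real linear factors\<close>

text \<open>The lines x = 0, y = 0 and x = y cut the plane into three double sectors. A symmetry of
  the form permutes them cyclically, so each contributes the same area, and the sector 0 < x/y < 1
  gives the Beta integral.\<close>

lemma emeasure_xy_form_region:
  "emeasure lborel {(x, y). \<bar>x * y * (x - y)\<bar> \<le> (1::real)} = ennreal (3 * Beta (1/3) (1/3))"
proof -
  define F :: "real \<times> real \<Rightarrow> real" where "F = (\<lambda>(x, y). x * y * (x - y))"
  have F: "F \<in> borel_measurable borel"
    unfolding F_def borel_prod[symmetric] by measurable
  have "F (c * x, c * y) = c ^ 3 * F (x, y)" for c x y
    by (simp add: F_def power3_eq_cube algebra_simps)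
  then have hom: "\<bar>F (c * x, c * y)\<bar> = \<bar>c\<bar> ^ 3 * \<bar>F (x, y)\<bar>" for c x y
    by (simp add: abs_mult power_abs)
  have nz: "AE t in lborel. F (t, 1) \<noteq> 0"
    using AE_lborel_singleton[of 0] AE_lborel_singleton[of 1] by eventually_elim (auto simp: F_def)
  let ?f = "\<lambda>t. ennreal (\<bar>F (t, 1)\<bar> powr (- 2 / 3))"
  let ?A = "\<lambda>P. emeasure lborel {(x, y). P x y \<and> \<bar>F (x, y)\<bar> \<le> 1}"
  have [measurable]: "?f \<in> borel_measurable borel"
    unfolding F_def by measurable
  have m: "(\<lambda>t. ?f t * indicator {0<..<1} t) \<in> borel_measurable lborel"
    "(\<lambda>t. ?f t * indicator {..<0} t) \<in> borel_measurable lborel"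
    "(\<lambda>t. ?f t * indicator {1<..} t) \<in> borel_measurable lborel"
    by measurable
  have sector: "(\<integral>\<^sup>+t. ?f t * indicator S t \<partial>lborel) = ?A P"
    if S: "S \<in> sets borel" and P: "\<And>x y. P x y \<longleftrightarrow> y \<noteq> 0 \<and> x / y \<in> S" for S P
    using emeasure_homogeneous_cone[OF F S hom nz] by (simp add: P conj_assoc)
  have P: "Measurable.pred borel (\<lambda>(x, y). - x * y > 0 \<and> \<bar>F (x, y)\<bar> \<le> 1)"
    "Measurable.pred borel (\<lambda>(x, y). y * (x - y) > 0 \<and> \<bar>F (x, y)\<bar> \<le> 1)"
    unfolding F_def borel_prod[symmetric] by measurable
  \<comment> \<open>The map (x, y) -> (-y, x - y) has determinant 1 and order 3 and leaves
    \<open>F\<close> invariant.\<close>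
  have rot1: "?A (\<lambda>x y. - x * y > 0) = ?A (\<lambda>x y. y * (x - y) > 0)"
    by (subst emeasure_linear_image[OF P(1), of 0 "-1" "-1" 1], simp, simp,
        rule arg_cong[where f = "emeasure lborel"]) (auto simp: F_def algebra_simps)
  have rot2: "?A (\<lambda>x y. y * (x - y) > 0) = ?A (\<lambda>x y. x * (y - x) > 0)"
    by (subst emeasure_linear_image[OF P(2), of 0 "-1" "-1" 1], simp, simp,
        rule arg_cong[where f = "emeasure lborel"]) (auto simp: F_def algebra_simps)
  have 1: "(\<integral>\<^sup>+t. ?f t * indicator {0<..<1} t \<partial>lborel) = ?A (\<lambda>x y. x * (y - x) > 0)"
  proof (rule sector)
    fix x y :: real
    show "x * (y - x) > 0 \<longleftrightarrow> y \<noteq> 0 \<and> x / y \<in> {0<..<1}"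
      by (cases y "0 :: real" rule: linorder_cases) (auto simp: zero_less_mult_iff divide_less_eq less_divide_eq divide_less_0_iff)
  qed auto
  have 2: "(\<integral>\<^sup>+t. ?f t * indicator {..<0} t \<partial>lborel) = ?A (\<lambda>x y. - x * y > 0)"
    by (rule sector) (auto simp: mult_less_0_iff divide_less_0_iff)
  have 3: "(\<integral>\<^sup>+t. ?f t * indicator {1<..} t \<partial>lborel) = ?A (\<lambda>x y. y * (x - y) > 0)"
  proof (rule sector)
    fix x y :: real
    show "y * (x - y) > 0 \<longleftrightarrow> y \<noteq> 0 \<and> x / y \<in> {1<..}"
      by (cases y "0 :: real" rule: linorder_cases) (auto simp: zero_less_mult_iff divide_less_eq less_divide_eq divide_less_0_iff)
  qed auto
  have "((\<lambda>t::real. t powr (1 / 3 - 1) * (1 - t) powr (1 / 3 - 1)) has_integral Beta (1/3) (1/3)) {0..1}"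
    by (rule has_integral_Beta_real) auto
  then have "ennreal (Beta (1/3) (1/3)) =
      (\<integral>\<^sup>+t. ennreal (indicator {0..1} t * (t powr (1 / 3 - 1) * (1 - t) powr (1 / 3 - 1))) \<partial>lborel)"
    by (intro nn_integral_has_integral_lebesgue[symmetric]) auto
  also have "\<dots> = (\<integral>\<^sup>+t. ?f t * indicator {0<..<1} t \<partial>lborel)"
    by (auto simp: indicator_def F_def abs_mult powr_mult intro!: nn_integral_cong)
  finally have B: "(\<integral>\<^sup>+t. ?f t * indicator {0<..<1} t \<partial>lborel) = ennreal (Beta (1/3) (1/3))" ..
  have "emeasure lborel {z. \<bar>F z\<bar> \<le> 1} = (\<integral>\<^sup>+t. ?f t \<partial>lborel)"
    using emeasure_homogeneous_region[OF F hom nz] by simp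
  also have "\<dots> = (\<integral>\<^sup>+t. ?f t * indicator {0<..<1} t + (?f t * indicator {..<0} t + ?f t * indicator {1<..} t) \<partial>lborel)"
    by (rule nn_integral_cong_AE, rule eventually_mono[OF nz]) (auto simp: F_def indicator_def)
  also have "\<dots> = ennreal (Beta (1/3) (1/3)) + (ennreal (Beta (1/3) (1/3)) + ennreal (Beta (1/3) (1/3)))"
  proof -
    have "(\<integral>\<^sup>+t. ?f t * indicator {..<0} t \<partial>lborel) = ennreal (Beta (1/3) (1/3))"
      "(\<integral>\<^sup>+t. ?f t * indicator {1<..} t \<partial>lborel) = ennreal (Beta (1/3) (1/3))"
      unfolding 2 3 rot1 rot2 1[symmetric] B by (rule refl)+
    then show ?thesis
      using B by (simp only: nn_integral_add[OF m(1) borel_measurable_add[OF m(2) m(3)]] nn_integral_add[OF m(2) m(3)])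
  qed
  also have "\<dots> = ennreal (3 * Beta (1/3) (1/3))"
    by (simp add: ennreal_plus[symmetric] Beta_def del: ennreal_plus)
  finally show ?thesis
    by (simp add: F_def case_prod_unfold)
qed

text \<open>
  With \<open>X = d\<^sub>2\<^sub>3 l\<^sub>1\<close> and \<open>Y = - d\<^sub>3\<^sub>1 l\<^sub>2\<close> the relation \<open>d\<^sub>2\<^sub>3 l\<^sub>1 + d\<^sub>3\<^sub>1 l\<^sub>2 + d\<^sub>1\<^sub>2 l\<^sub>3 = 0\<close> turns
  \<open>X Y (X - Y)\<close> into a multiple of \<open>l\<^sub>1 l\<^sub>2 l\<^sub>3\<close>.
\<close>

lemma nn_integral_real_cubic:
  fixes a1 b1 a2 b2 a3 b3 :: real
  defines "P \<equiv> (a1 * b2 - a2 * b1) * (a2 * b3 - a3 * b2) * (a3 * b1 - a1 * b3)"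
  assumes P: "P \<noteq> 0"
  shows "(\<integral>\<^sup>+t. ennreal (\<bar>P\<bar> powr (1/3) * \<bar>(a1 * t - b1) * (a2 * t - b2) * (a3 * t - b3)\<bar> powr (-2/3)) \<partial>lborel) =
    ennreal (3 * Beta (1/3) (1/3))"
proof -
  define L where "L = (\<lambda>(x, y). (a1 * x - b1 * y) * (a2 * x - b2 * y) * (a3 * x - b3 * y))"
  \<comment> \<open>\<open>P\<close> is both the multiple by which X Y (X - Y) differs from
    \<open>L\<close> and the determinant of the map to the coordinates X, Y. Hence the factor |P|
    |P|^(-2/3) = |P|^(1/3).\<close>
  define F where "F = (\<lambda>z. P * L z)"
  have F: "F \<in> borel_measurable borel"
    unfolding F_def L_def borel_prod[symmetric] by measurable
  have "F (c * x, c * y) = c ^ 3 * F (x, y)" for c x y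
    by (simp add: F_def L_def power3_eq_cube algebra_simps)
  then have hom: "\<bar>F (c * x, c * y)\<bar> = \<bar>c\<bar> ^ 3 * \<bar>F (x, y)\<bar>" for c x y
    by (simp add: abs_mult power_abs)
  have nzl: "AE t in lborel. a * t - b \<noteq> 0" if "a \<noteq> 0 \<or> b \<noteq> 0" for a b :: real
    by (rule eventually_mono[OF AE_lborel_singleton[of "b / a"]]) (use that in \<open>auto simp: field_simps\<close>)
  have nz: "AE t in lborel. F (t, 1) \<noteq> 0"
  proof -
    have "a1 \<noteq> 0 \<or> b1 \<noteq> 0" "a2 \<noteq> 0 \<or> b2 \<noteq> 0" "a3 \<noteq> 0 \<or> b3 \<noteq> 0"
      using P by (auto simp: P_def)
    from this[THEN nzl] show ?thesis
      by eventually_elim (use P in \<open>simp add: F_def L_def\<close>)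
  qed
  let ?d1 = "a2 * b3 - a3 * b2" and ?d2 = "a3 * b1 - a1 * b3"
  have X: "(?d1 * a1 * x + (- ?d1 * b1) * y) * ((- ?d2 * a2) * x + (?d2 * b2) * y) *
      ((?d1 * a1 * x + (- ?d1 * b1) * y) - ((- ?d2 * a2) * x + (?d2 * b2) * y)) = F (x, y)" for x y
    by (simp add: F_def L_def P_def) Groebner_Basis.algebra
  have D: "(?d1 * a1) * (?d2 * b2) - (- ?d1 * b1) * (- ?d2 * a2) = P"
    by (simp add: P_def) Groebner_Basis.algebra
  have M: "Measurable.pred borel (\<lambda>(x, y). \<bar>x * y * (x - y)\<bar> \<le> (1::real))"
    unfolding borel_prod[symmetric] by measurable
  have "ennreal (3 * Beta (1/3) (1/3)) = ennreal \<bar>P\<bar> * emeasure lborel {(x, y). \<bar>F (x, y)\<bar> \<le> 1}"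
    using emeasure_linear_image[OF M, of "?d1 * a1" "?d2 * b2" "- ?d1 * b1" "- ?d2 * a2"] P
    unfolding D case_prod_conv X emeasure_xy_form_region by simp
  also have "\<dots> = ennreal \<bar>P\<bar> * (\<integral>\<^sup>+t. ennreal (\<bar>F (t, 1)\<bar> powr (-2/3)) \<partial>lborel)"
    using emeasure_homogeneous_region[OF F hom nz] by (simp add: case_prod_unfold)
  also have "\<dots> = (\<integral>\<^sup>+t. ennreal \<bar>P\<bar> * ennreal (\<bar>F (t, 1)\<bar> powr (-2/3)) \<partial>lborel)"
    unfolding F_def L_def by (rule nn_integral_cmult[symmetric]) measurable
  also have "\<dots> = (\<integral>\<^sup>+t. ennreal (\<bar>P\<bar> powr (1/3) * \<bar>L (t, 1)\<bar> powr (-2/3)) \<partial>lborel)"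
  proof (rule nn_integral_cong)
    fix t
    have "\<bar>P\<bar> * \<bar>F (t, 1)\<bar> powr (-2/3) = (\<bar>P\<bar> powr 1 * \<bar>P\<bar> powr (-2/3)) * \<bar>L (t, 1)\<bar> powr (-2/3)"
      using P by (simp add: F_def abs_mult powr_mult)
    also have "\<bar>P\<bar> powr 1 * \<bar>P\<bar> powr (-2/3) = \<bar>P\<bar> powr (1/3)"
      by (subst powr_add[symmetric]) simp
    finally show "ennreal \<bar>P\<bar> * ennreal (\<bar>F (t, 1)\<bar> powr (-2/3)) = ennreal (\<bar>P\<bar> powr (1/3) * \<bar>L (t, 1)\<bar> powr (-2/3))"
      by (subst ennreal_mult[symmetric]) auto
  qed
  finally show ?thesis by (simp add: L_def)
qed

section \<open>The discriminant of an integer form\<close>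

text \<open>Eliminating \<open>\<rho> i\<close> from two of the relations shows that
  \<open>b i j * b i (Suc m) - b i (Suc j) * b i m\<close> is linear in the \<open>b i\<close> with
  coefficients among the \<open>A\<close>. Modulo integers, the pairing therefore depends on j + m
  only, and induction lowers m to 0.\<close>

lemma pairing_sum_Ints:
  fixes b :: "nat \<Rightarrow> nat \<Rightarrow> complex" and \<rho> :: "nat \<Rightarrow> complex"
  assumes A0: "\<And>i. i \<in> I \<Longrightarrow> A 0 = - \<rho> i * b i 0"
    and AS: "\<And>i j. i \<in> I \<Longrightarrow> A (Suc j) = b i j - \<rho> i * b i (Suc j)"
    and A: "\<And>j. A j \<in> \<int>" and T: "\<And>j. (\<Sum>i\<in>I. b i j) \<in> \<int>"
  shows "(\<Sum>i\<in>I. b i j * b i m) \<in> \<int>"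
proof (induction m arbitrary: j)
  case 0
  have "(\<Sum>i\<in>I. b i j * b i 0) = (\<Sum>i\<in>I. A (Suc j) * b i 0 - A 0 * b i (Suc j))"
  proof (rule sum.cong)
    fix i assume i: "i \<in> I"
    show "b i j * b i 0 = A (Suc j) * b i 0 - A 0 * b i (Suc j)"
      unfolding A0[OF i] AS[OF i, of j] by (simp add: algebra_simps)
  qed simp
  also have "\<dots> = A (Suc j) * (\<Sum>i\<in>I. b i 0) - A 0 * (\<Sum>i\<in>I. b i (Suc j))"
    by (simp add: sum_subtractf sum_distrib_left)
  finally show ?case
    using A T by (metis Ints_diff Ints_mult)
next
  case (Suc m)
  have "(\<Sum>i\<in>I. b i j * b i (Suc m)) =
    (\<Sum>i\<in>I. b i (Suc j) * b i m + (A (Suc j) * b i (Suc m) - A (Suc m) * b i (Suc j)))"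
  proof (rule sum.cong)
    fix i assume i: "i \<in> I"
    show "b i j * b i (Suc m) = b i (Suc j) * b i m + (A (Suc j) * b i (Suc m) - A (Suc m) * b i (Suc j))"
      unfolding AS[OF i, of m] AS[OF i, of j] by (simp add: algebra_simps)
  qed simp
  also have "\<dots> = (\<Sum>i\<in>I. b i (Suc j) * b i m) +
      (A (Suc j) * (\<Sum>i\<in>I. b i (Suc m)) - A (Suc m) * (\<Sum>i\<in>I. b i (Suc j)))"
    by (simp add: sum_subtractf sum_distrib_left sum.distrib)
  finally show ?case
    using A T Suc.IH by (metis Ints_add Ints_diff Ints_mult)
qed

lemma det_diagonal:
  fixes d :: "nat \<Rightarrow> 'a::comm_ring_1"
  shows "det (mat n n (\<lambda>(i, j). if i = j then d i else 0)) = (\<Prod>i<n. d i)"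
  by (subst det_upper_triangular[of _ n])
    (auto simp: diag_mat_def upper_triangular_def prod.list_conv_set_nth atLeast0LessThan intro!: prod.cong)

text \<open>The reversal matrix is an involution. Its sign varies with n, but only its modulus is
  wanted.\<close>

lemma det_reversal_sq:
  "(det (mat n n (\<lambda>(i, j). if i + j = n - 1 then 1 else 0)) :: complex)\<^sup>2 = 1" (is "(det ?R)\<^sup>2 = 1")
proof -
  have "?R * ?R = 1\<^sub>m n"
  proof (rule eq_matI)
    fix i j assume ij: "i < dim_row (1\<^sub>m n :: complex mat)" "j < dim_col (1\<^sub>m n :: complex mat)"
    then have "(?R * ?R) $$ (i, j) = (\<Sum>k<n. (if k = n - 1 - i then 1 else 0) * (if k + j = n - 1 then 1 else 0))"
      by (auto simp: scalar_prod_def atLeast0LessThan intro!: sum.cong)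
    also have "\<dots> = (\<Sum>k<n. if k = n - 1 - i then (if i = j then 1 else 0) else 0)"
      using ij by (intro sum.cong) auto
    finally show "(?R * ?R) $$ (i, j) = 1\<^sub>m n $$ (i, j)"
      using ij by (simp add: sum.delta)
  qed auto
  then show ?thesis
    unfolding power2_eq_square by (subst det_mult[of _ n, symmetric]) auto
qed

text \<open>
  Row \<open>i\<close> of \<open>B\<close> lists the coefficients of the quotient of \<open>p\<close> by \<open>X - \<rho> i\<close>. The entries of
  \<open>B\<^sup>T B\<close> are integers, but its determinant is the discriminant times \<open>c\<^sup>2\<close>; in \<open>Q\<close> the column of
  leading coefficients \<open>c\<close> is replaced by ones, which removes that factor and keeps the entries
  of \<open>Q\<^sup>T Q\<close> integral.
\<close>

lemma norm_discriminant_poly_ge_1: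
  fixes p :: "int poly" and \<rho> :: "nat \<Rightarrow> complex" and c :: int
  assumes fac: "map_poly of_int p = Polynomial.smult (of_int c) (\<Prod>i<n. [:- \<rho> i, 1:])"
    and c: "c \<noteq> 0" and n: "n > 0"
    and nz: "disc_of_factors n (\<lambda>_. 1) \<rho> \<noteq> 0"
  shows "norm (of_int c :: complex) ^ (2 * (n - 1)) * norm (disc_of_factors n (\<lambda>_. 1) \<rho>) \<ge> 1"
proof -
  let ?c = "of_int c :: complex"
  let ?\<Delta> = "disc_of_factors n (\<lambda>_. 1) \<rho>"
  define P :: "complex poly" where "P = map_poly of_int p"
  define A where "A j = coeff P j" for j
  define q where "q i = Polynomial.smult ?c (\<Prod>l\<in>{..<n} - {i}. [:- \<rho> l, 1:])" for i
  define b where "b i j = coeff (q i) j" for i j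
  have A_int: "A j \<in> \<int>" for j
    by (simp add: A_def P_def coeff_map_poly)
  have Pq: "P = [:- \<rho> i, 1:] * q i" if "i < n" for i
    using that unfolding P_def fac q_def by (subst prod.remove[of _ i]) auto
  have A0: "A 0 = - \<rho> i * b i 0" and AS: "A (Suc j) = b i j - \<rho> i * b i (Suc j)" if "i < n" for i j
    by (simp_all add: A_def Pq[OF that] b_def)
  have deg: "degree (q i) \<le> n - 1" if "i < n" for i
  proof -
    have "degree (\<Prod>l\<in>{..<n} - {i}. [:- \<rho> l, 1:]) \<le> sum (degree \<circ> (\<lambda>l. [:- \<rho> l, 1:])) ({..<n} - {i})"
      by (intro degree_prod_sum_le) auto
    then show ?thesis using that c by (simp add: q_def)
  qed
  have b0: "b i j = 0" if "i < n" "j \<ge> n" for i j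
    using that(2) n deg[OF that(1)] unfolding b_def by (intro coeff_eq_0) linarith
  have An: "A n = ?c"
  proof -
    have "lead_coeff (\<Prod>i<n. [:- \<rho> i, 1:]) = 1"
      by (simp add: lead_coeff_prod)
    moreover have "degree (\<Prod>i<n. [:- \<rho> i, 1:]) = n"
      by (subst degree_prod_eq_sum_degree) auto
    ultimately show ?thesis by (simp add: A_def P_def fac)
  qed
  \<comment> \<open>The derivative is the sum of the quotients of \<open>P\<close> by its linear
    factors, so the column sums of the \<open>b i j\<close> are coefficients of an integer
    polynomial.\<close>
  have "pderiv P = (\<Sum>i<n. q i)"
    unfolding P_def fac q_def
    using sum_distrib_left[of "[:?c:]" "\<lambda>i. \<Prod>l\<in>{..<n} - {i}. [:- \<rho> l, 1:]" "{..<n}"]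
    by (simp add: pderiv_smult pderiv_prod pderiv_pCons)
  then have "(\<Sum>i<n. b i j) = of_nat (Suc j) * A (Suc j)" for j
    unfolding A_def b_def coeff_pderiv[symmetric] coeff_sum[symmetric] by (simp only:)
  then have T_int: "(\<Sum>i<n. b i j) \<in> \<int>" for j
    using A_int[of "Suc j"] by (simp only: Ints_mult Ints_of_nat)
  have S_int: "(\<Sum>i<n. b i j * b i m) \<in> \<int>" for j m
    by (rule pairing_sum_Ints[where \<rho> = \<rho> and A = A]) (use A0 AS A_int T_int in auto)
  \<comment> \<open>The Vandermonde determinant is not expanded. On one side
    \<open>B = V * U\<close> with \<open>det U\<close> equal to c^n; on the other,
    \<open>B * R * V^T\<close> is diagonal, because \<open>q i\<close> vanishes at every root of
    other index. Comparing the two gives |det V|^2 as the modulus of the discriminant of the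
    roots.\<close>
  define V where "V = mat n n (\<lambda>(i, j). \<rho> i ^ j)"
  define U where "U = mat n n (\<lambda>(m, k). if m \<le> k then A (n - k + m) else 0)"
  define R where "R = (mat n n (\<lambda>(i, j). if i + j = n - 1 then 1 else 0) :: complex mat)"
  define B where "B = mat n n (\<lambda>(i, k). b i (n - 1 - k))"
  define Q where "Q = mat n n (\<lambda>(i, k). if k = 0 then 1 else b i (n - 1 - k))"
  have carr: "V \<in> carrier_mat n n" "U \<in> carrier_mat n n" "R \<in> carrier_mat n n"
    "B \<in> carrier_mat n n" "Q \<in> carrier_mat n n"
    by (auto simp: V_def U_def R_def B_def Q_def)
  \<comment> \<open>Synthetic division produces the coefficients of the quotient from the top down.
    The reversed columns of \<open>B\<close> make \<open>U\<close> upper triangular with the leading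
    coefficient on its diagonal.\<close>
  have horner: "(\<Sum>m\<le>k. \<rho> i ^ m * A (n - k + m)) = b i (n - 1 - k)" if "i < n" "k < n" for i k
    using that(2)
  proof (induction k)
    case 0
    then show ?case using AS[OF that(1), of "n - 1"] b0[OF that(1), of n] by simp
  next
    case (Suc k)
    have "(\<Sum>m\<le>Suc k. \<rho> i ^ m * A (n - Suc k + m)) = A (n - Suc k) + \<rho> i * (\<Sum>m\<le>k. \<rho> i ^ m * A (n - k + m))"
      using Suc.prems by (subst sum.atMost_Suc_shift) (simp add: sum_distrib_left mult.assoc Suc_diff_Suc)
    also have "\<dots> = A (n - Suc k) + \<rho> i * b i (n - 1 - k)"
      using Suc by simp
    also have "\<dots> = b i (n - 1 - Suc k)"
      using AS[OF that(1), of "n - 1 - Suc k"] Suc.prems by (simp add: Suc_diff_Suc)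
    finally show ?case .
  qed
  have "B = V * U"
  proof (rule eq_matI)
    fix i k assume "i < dim_row (V * U)" "k < dim_col (V * U)"
    then have ik: "i < n" "k < n" by (auto simp: V_def U_def)
    then have "(V * U) $$ (i, k) = (\<Sum>m<n. \<rho> i ^ m * (if m \<le> k then A (n - k + m) else 0))"
      by (simp add: V_def U_def scalar_prod_def atLeast0LessThan)
    also have "\<dots> = (\<Sum>m\<le>k. \<rho> i ^ m * A (n - k + m))"
      using ik by (intro sum.mono_neutral_cong_right) auto
    also have "\<dots> = b i (n - 1 - k)"
      by (rule horner[OF ik])
    finally show "B $$ (i, k) = (V * U) $$ (i, k)"
      using ik by (simp add: B_def)
  qed (auto simp: V_def U_def B_def)
  moreover have "det U = ?c ^ n"
  proof -
    have "det U = prod_list (diag_mat U)"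
      by (rule det_upper_triangular[OF _ carr(2)]) (simp add: U_def upper_triangular_def)
    also have "\<dots> = (\<Prod>i<n. ?c)"
      by (auto simp: U_def diag_mat_def prod.list_conv_set_nth atLeast0LessThan An intro!: prod.cong)
    finally show ?thesis by simp
  qed
  ultimately have detB: "det B = det V * ?c ^ n"
    using carr by (simp add: det_mult)
  have "B = Q * mat n n (\<lambda>(i, j). if i = j then (if i = 0 then ?c else 1) else 0)" (is "_ = Q * ?D")
  proof (rule eq_matI)
    fix i k assume "i < dim_row (Q * ?D)" "k < dim_col (Q * ?D)"
    then have ik: "i < n" "k < n" by (auto simp: Q_def)
    then have "(Q * ?D) $$ (i, k) = (\<Sum>m<n. Q $$ (i, m) * ?D $$ (m, k))"
      using carr by (simp add: scalar_prod_def atLeast0LessThan)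
    also have "\<dots> = (\<Sum>m<n. if m = k then Q $$ (i, k) * (if k = 0 then ?c else 1) else 0)"
      using ik by (intro sum.cong) auto
    also have "\<dots> = Q $$ (i, k) * (if k = 0 then ?c else 1)"
      using ik by (simp add: sum.delta)
    finally have QD: "(Q * ?D) $$ (i, k) = Q $$ (i, k) * (if k = 0 then ?c else 1)" .
    show "B $$ (i, k) = (Q * ?D) $$ (i, k)"
      unfolding QD using ik horner[of i 0] An by (auto simp: B_def Q_def)
  qed (auto simp: Q_def B_def)
  then have "det B = det Q * (\<Prod>i<n. if i = 0 then ?c else 1)"
    using carr det_diagonal[of n "\<lambda>i. if i = 0 then ?c else 1"] by (simp add: det_mult)
  also have "(\<Prod>i<n. if i = 0 then ?c else 1) = ?c"
    using n by (subst prod.delta) auto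
  finally have "det Q * ?c = det V * ?c ^ (n - 1) * ?c"
    using detB n by (simp add: mult.assoc power_Suc2[symmetric] del: power_Suc)
  then have detQ: "det Q = det V * ?c ^ (n - 1)"
    using c by simp
  have "B * R * transpose_mat V = mat n n (\<lambda>(i, j). if i = j then poly (q i) (\<rho> i) else 0)"
  proof (rule eq_matI)
    fix i j assume "i < dim_row (mat n n (\<lambda>(i, j). if i = j then poly (q i) (\<rho> i) else 0))"
      "j < dim_col (mat n n (\<lambda>(i, j). if i = j then poly (q i) (\<rho> i) else 0))"
    then have ij: "i < n" "j < n" by auto
    have BR: "(B * R) $$ (i, k) = b i k" if "k < n" for k
    proof -
      have "(B * R) $$ (i, k) = (\<Sum>m<n. B $$ (i, m) * R $$ (m, k))"
        using ij that carr by (simp add: scalar_prod_def atLeast0LessThan)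
      also have "\<dots> = (\<Sum>m<n. if m = n - 1 - k then b i k else 0)"
        using ij that by (intro sum.cong) (auto simp: B_def R_def)
      finally show ?thesis using that by (simp add: sum.delta)
    qed
    have "(M * transpose_mat V) $$ (i, j) = (\<Sum>k<n. M $$ (i, k) * V $$ (j, k))" if "M \<in> carrier_mat n n" for M
      using ij carr that by (simp add: scalar_prod_def atLeast0LessThan)
    from this[of "B * R"]
    have "(B * R * transpose_mat V) $$ (i, j) = (\<Sum>k<n. (B * R) $$ (i, k) * V $$ (j, k))"
      using carr mult_carrier_mat by blast
    also have "\<dots> = (\<Sum>k<n. (B * R) $$ (i, k) * \<rho> j ^ k)"
      using ij by (intro sum.cong) (auto simp: V_def)
    also have "\<dots> = (\<Sum>k<n. b i k * \<rho> j ^ k)"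
      by (simp add: BR)
    also have "\<dots> = poly (q i) (\<rho> j)"
    proof -
      have "(\<Sum>k<n. b i k * \<rho> j ^ k) = (\<Sum>k\<le>degree (q i). coeff (q i) k * \<rho> j ^ k)"
        unfolding b_def[symmetric]
        by (rule sum.mono_neutral_cong) (use b0 ij in \<open>auto simp: b_def not_less not_le coeff_eq_0\<close>)
      then show ?thesis by (simp add: poly_altdef)
    qed
    also have "\<dots> = (if i = j then poly (q i) (\<rho> i) else 0)"
      using ij by (auto simp: q_def poly_prod)
    finally show "(B * R * transpose_mat V) $$ (i, j) =
        mat n n (\<lambda>(i, j). if i = j then poly (q i) (\<rho> i) else 0) $$ (i, j)"
      using ij by simp
  qed (auto simp: B_def V_def)
  then have "det B * det R * det V = (\<Prod>i<n. poly (q i) (\<rho> i))"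
    using carr det_diagonal[of n "\<lambda>i. poly (q i) (\<rho> i)"]
      det_mult[of "B * R" n "transpose_mat V"] det_mult[of B n R] det_transpose[of V n] by auto
  also have "\<dots> = ?c ^ n * ordered_disc {..<n} (\<lambda>_. 1) \<rho>"
    by (simp add: q_def poly_prod ordered_disc_def prod.distrib)
  finally have "norm (det B * det R * det V) = norm (?c ^ n * ordered_disc {..<n} (\<lambda>_. 1) \<rho>)"
    by simp
  then have "norm (det V) ^ 2 * norm (det R) * norm ?c ^ n = norm ?c ^ n * norm ?\<Delta>"
    unfolding detB ordered_disc_eq
    by (simp add: norm_mult norm_power power2_eq_square mult_ac)
  moreover have "norm (det R) = 1"
    using det_reversal_sq[of n] unfolding R_def[symmetric]
    by (auto simp: power2_eq_1_iff)
  ultimately have detV: "norm (det V) ^ 2 = norm ?\<Delta>"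
    using c by simp
  \<comment> \<open>There are three kinds of entries: the corner n, column sums of the
    \<open>b i j\<close>, and pairings of two columns.\<close>
  have Qint: "(transpose_mat Q * Q) $$ (k, m) \<in> \<int>" if "k < n" "m < n" for k m
  proof -
    have "(transpose_mat Q * Q) $$ (k, m) = (\<Sum>i<n. (if k = 0 then 1 else b i (n - 1 - k)) * (if m = 0 then 1 else b i (n - 1 - m)))"
      using that by (simp add: Q_def scalar_prod_def atLeast0LessThan)
    then show ?thesis
      using S_int T_int by (cases "k = 0"; cases "m = 0") simp_all
  qed
  have fl: "of_int \<lfloor>Re z\<rfloor> = z" if "z \<in> \<int>" for z :: complex
    using that by (elim Ints_cases) simp
  define N where "N = mat n n (\<lambda>(k, m). \<lfloor>Re ((transpose_mat Q * Q) $$ (k, m))\<rfloor>)"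
  have "transpose_mat Q * Q = map_mat of_int N"
    using fl[OF Qint] carr by (intro eq_matI) (auto simp: N_def)
  moreover have "det (transpose_mat Q * Q) = det Q ^ 2"
    using carr by (simp add: det_mult det_transpose power2_eq_square)
  ultimately have "det Q ^ 2 = of_int (det N)"
    by simp
  moreover have "norm (det Q ^ 2) = norm ?c ^ (2 * (n - 1)) * norm ?\<Delta>"
    unfolding detQ detV[symmetric] by (simp add: norm_mult norm_power power_mult_distrib power_mult[symmetric] mult.commute)
  ultimately have eq: "norm ?c ^ (2 * (n - 1)) * norm ?\<Delta> = real_of_int \<bar>det N\<bar>"
    by simp
  moreover have "norm ?c ^ (2 * (n - 1)) * norm ?\<Delta> \<noteq> 0"
    using c nz by simp
  ultimately have "det N \<noteq> 0"
    by auto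
  then show ?thesis
    unfolding eq of_int_1_le_iff by linarith
qed

lemma norm_disc_of_factors: "norm (disc_of_factors n \<alpha> \<beta>) = norm (ordered_disc {..<n} \<alpha> \<beta>)"
  by (simp add: ordered_disc_eq norm_mult norm_power)

text \<open>The leading coefficient may vanish. The shear Y -> Y + m X keeps the coefficients
  integral and all pairwise determinants unchanged, and for a suitable integer m the new leading
  coefficient F(1, m) is nonzero. Then the polynomial F(X, 1 + m X) has full degree n.\<close>

lemma norm_form_disc_ge_1:
  assumes D: "form_disc n a \<noteq> 0" and n: "n \<ge> 2"
  shows "norm (form_disc n a) \<ge> 1"
proof -
  obtain \<alpha> \<beta> where fac: "linear_factorization n a \<alpha> \<beta>"
    using linear_factorization_exists[of n a] n by auto
  then have Deq: "form_disc n a = disc_of_factors n \<alpha> \<beta>"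
    by (rule form_disc_eq)
  then have D': "ordered_disc {..<n} \<alpha> \<beta> \<noteq> 0"
    using D by (simp add: ordered_disc_eq)
  have nzf: "\<alpha> i \<noteq> 0 \<or> \<beta> i \<noteq> 0" if "i < n" for i
    using ordered_disc_zero_factor[of "{..<n}" i \<alpha> \<beta>] D' that n by auto
  have "finite ((\<lambda>i. \<alpha> i / \<beta> i) ` {..<n})"
    by simp
  moreover have "infinite (range (of_int :: int \<Rightarrow> complex))"
    using infinite_UNIV_char_0[where 'a = int] by (auto simp: inj_on_def dest!: finite_imageD)
  \<comment> \<open>Only finitely many quotients must be avoided. If \<open>\<beta> i = 0\<close>
    the quotient is 0 by convention, which merely excludes m = 0.\<close>
  ultimately have "\<not> range (of_int :: int \<Rightarrow> complex) \<subseteq> (\<lambda>i. \<alpha> i / \<beta> i) ` {..<n}"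
    using finite_subset by blast
  then obtain m :: int where m: "of_int m \<notin> (\<lambda>i. \<alpha> i / \<beta> i) ` {..<n}"
    by blast
  define \<alpha>' where "\<alpha>' i = \<alpha> i - \<beta> i * of_int m" for i
  have \<alpha>': "\<alpha>' i \<noteq> 0" if "i < n" for i
  proof
    assume "\<alpha>' i = 0"
    then have "\<alpha> i = \<beta> i * of_int m"
      by (simp add: \<alpha>'_def)
    moreover from this nzf[OF that] have "\<beta> i \<noteq> 0"
      by auto
    ultimately have "of_int m = \<alpha> i / \<beta> i"
      by simp
    then show False
      using m that by auto
  qed
  define \<rho> where "\<rho> i = \<beta> i / \<alpha>' i" for i
  define c where "c = (\<Sum>i\<le>n. a i * m ^ i)"
  have "of_int c = (eval_form n a 1 (of_int m) :: complex)"
    by (simp add: c_def eval_form_def)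
  also have "\<dots> = (\<Prod>i<n. \<alpha>' i)"
    using fac by (simp add: linear_factorization_def \<alpha>'_def)
  finally have c: "of_int c = (\<Prod>i<n. \<alpha>' i)" .
  have c0: "c \<noteq> 0"
  proof -
    have "(\<Prod>i<n. \<alpha>' i) \<noteq> 0"
      using \<alpha>' by simp
    then show ?thesis
      using c by auto
  qed
  have split: "(\<Prod>i<n. \<alpha>' i * x - \<beta> i * y) = of_int c * (\<Prod>i<n. 1 * x - \<rho> i * y)" for x y
    unfolding c prod.distrib[symmetric] using \<alpha>' by (intro prod.cong) (auto simp: \<rho>_def algebra_simps)
  define p :: "int poly" where "p = (\<Sum>i\<le>n. [:a i:] * [:0, 1:] ^ (n - i) * [:1, m:] ^ i)"
  have "map_poly of_int p = Polynomial.smult (of_int c) (\<Prod>i<n. [:- \<rho> i, 1:])"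
  proof (rule poly_eq_poly_eq_iff[THEN iffD1], rule ext)
    fix x :: complex
    have const: "map_poly of_int [:m:] = [:of_int m :: complex:]"
      by (rule poly_eqI) (simp add: coeff_map_poly coeff_pCons split: nat.splits)
    have "poly (map_poly of_int p) x = eval_form n a x (1 + of_int m * x)"
      unfolding p_def eval_form_def
      by (simp add: of_int_poly_hom.hom_sum of_int_poly_hom.hom_mult of_int_poly_hom.hom_power poly_sum map_poly_pCons of_int_hom.map_poly_hom_smult const mult_ac)
    also have "\<dots> = (\<Prod>i<n. \<alpha> i * x - \<beta> i * (1 + of_int m * x))"
      using fac by (simp add: linear_factorization_def)
    also have "\<dots> = (\<Prod>i<n. \<alpha>' i * x - \<beta> i * 1)"
      by (simp add: \<alpha>'_def algebra_simps)
    also have "\<dots> = poly (Polynomial.smult (of_int c) (\<Prod>i<n. [:- \<rho> i, 1:])) x"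
      unfolding split by (simp add: poly_prod)
    finally show "poly (map_poly of_int p) x = poly (Polynomial.smult (of_int c) (\<Prod>i<n. [:- \<rho> i, 1:])) x" .
  qed
  moreover have shift: "ordered_disc {..<n} \<alpha> \<beta> = ordered_disc {..<n} \<alpha>' \<beta>"
    by (simp add: ordered_disc_def \<alpha>'_def algebra_simps)
  have eq: "ordered_disc {..<n} \<alpha> \<beta> = of_int c ^ (2 * (n - 1)) * ordered_disc {..<n} (\<lambda>_. 1) \<rho>"
    unfolding shift by (rule ordered_disc_scale[OF _ _ _ _ split]) auto
  then have "disc_of_factors n (\<lambda>_. 1) \<rho> \<noteq> 0"
    using D' by (auto simp: ordered_disc_eq)
  ultimately have "norm (of_int c :: complex) ^ (2 * (n - 1)) * norm (disc_of_factors n (\<lambda>_. 1) \<rho>) \<ge> 1"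
    using c0 n by (intro norm_discriminant_poly_ge_1) auto
  then show ?thesis
    unfolding Deq norm_disc_of_factors eq by (simp add: norm_mult norm_power)
qed

section \<open>Forms equivalent to \<open>X Y (X - Y)\<close>\<close>

no_notation Matrix.vec_index (infixl "$" 100)

lemma abs_det_invertible_int:
  fixes T :: "int^2^2"
  assumes "invertible T"
  shows "\<bar>T $ 1 $ 1 * T $ 2 $ 2 - T $ 1 $ 2 * T $ 2 $ 1\<bar> = 1"
proof -
  obtain S where S: "T ** S = Finite_Cartesian_Product.mat 1"
    using assms by (auto simp: invertible_def)
  have "T $ 1 $ 1 * S $ 1 $ 1 + T $ 1 $ 2 * S $ 2 $ 1 = 1"
    "T $ 1 $ 1 * S $ 1 $ 2 + T $ 1 $ 2 * S $ 2 $ 2 = 0"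
    "T $ 2 $ 1 * S $ 1 $ 1 + T $ 2 $ 2 * S $ 2 $ 1 = 0"
    "T $ 2 $ 1 * S $ 1 $ 2 + T $ 2 $ 2 * S $ 2 $ 2 = 1"
    using S by (simp_all add: Finite_Cartesian_Product.vec_eq_iff matrix_matrix_mult_def Finite_Cartesian_Product.mat_def forall_2 sum_2)
  then have "(T $ 1 $ 1 * T $ 2 $ 2 - T $ 1 $ 2 * T $ 2 $ 1) * (S $ 1 $ 1 * S $ 2 $ 2 - S $ 1 $ 2 * S $ 2 $ 1) = 1"
    by Groebner_Basis.algebra
  then show ?thesis
    by (metis dvd_triv_left zdvd1_eq)
qed

lemma eval_form_3: "eval_form 3 b x y = of_int (b 0) * x ^ 3 + of_int (b 1) * x ^ 2 * y + of_int (b 2) * x * y ^ 2 + of_int (b 3) * y ^ 3"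
  by (simp add: eval_form_def eval_nat_numeral)

text \<open>Equivalence is given at integer points, while the area and the factorization need it
  over the reals and complex numbers. The values at (1,0), (0,1), (1,1) and (1,-1) determine the
  four coefficients, and the identity then holds in every commutative ring.\<close>

lemma eval_equivalent_xy_form:
  fixes p q r s :: int
  assumes eq: "\<And>x y :: int. eval_form 3 b x y = eval_form 3 xy_form (p * x + q * y) (r * x + s * y)"
  shows "eval_form 3 b x y = (of_int p * x + of_int q * y) * (of_int r * x + of_int s * y) *
    ((of_int p * x + of_int q * y) - (of_int r * x + of_int s * y))"
proof -
  have e: "b 0 * x ^ 3 + b 1 * x ^ 2 * y + b 2 * x * y ^ 2 + b 3 * y ^ 3 =
    (p * x + q * y) * (r * x + s * y) * ((p * x + q * y) - (r * x + s * y))" for x y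
    using eq[of x y] unfolding eval_xy_form eval_form_3[of b] of_int_eq_id id_apply .
  have b0: "b 0 = p * r * (p - r)" and b3: "b 3 = q * s * (q - s)"
    using e[of 1 0] e[of 0 1] by simp_all
  have "b 0 + b 1 + b 2 + b 3 = (p + q) * (r + s) * ((p + q) - (r + s))"
    "b 0 - b 1 + b 2 - b 3 = (p - q) * (r - s) * ((p - q) - (r - s))"
    using e[of 1 1] e[of 1 "-1"] by (simp_all del: One_nat_def)
  then have "2 * b 2 = (p + q) * (r + s) * ((p + q) - (r + s)) + (p - q) * (r - s) * ((p - q) - (r - s)) - 2 * b 0"
    "2 * b 1 = (p + q) * (r + s) * ((p + q) - (r + s)) - (p - q) * (r - s) * ((p - q) - (r - s)) - 2 * b 3"
    by linarith+
  then have "2 * b 2 = 2 * ((p - r) * q * s + (q - s) * (p * s + q * r))"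
    "2 * b 1 = 2 * (p * r * (q - s) + (p - r) * (p * s + q * r))"
    unfolding b0 b3 by Groebner_Basis.algebra+
  then have b12: "b 2 = (p - r) * q * s + (q - s) * (p * s + q * r)" "b 1 = p * r * (q - s) + (p - r) * (p * s + q * r)"
    by simp_all
  show ?thesis
    unfolding eval_form_3 b0 b3 b12 by (simp add: power2_eq_square power3_eq_cube algebra_simps)
qed

lemma equivalent_xy_form:
  assumes "GL2Z_equivalent 3 xy_form b"
  shows "form_disc 3 b \<noteq> 0" and "form_area 3 b = ennreal (3 * Beta (1/3) (1/3))"
proof -
  obtain T :: "int^2^2" where T: "invertible T" and eq: "\<And>x y :: int. eval_form 3 b x y =
      eval_form 3 xy_form (T $ 1 $ 1 * x + T $ 1 $ 2 * y) (T $ 2 $ 1 * x + T $ 2 $ 2 * y)"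
    using assms unfolding GL2Z_equivalent_def by blast
  define p q r s where pqrs: "p = T $ 1 $ 1" "q = T $ 1 $ 2" "r = T $ 2 $ 1" "s = T $ 2 $ 2"
  have det: "\<bar>p * s - q * r\<bar> = 1"
    using abs_det_invertible_int[OF T] unfolding pqrs .
  note ev = eval_equivalent_xy_form[of b p q r s, OF eq[folded pqrs]]
  \<comment> \<open>The factors are pX + qY, rX + sY and their difference. Each pairwise determinant
    is plus or minus ps - qr, whence the sixth power in the discriminant.\<close>
  define \<alpha> :: "nat \<Rightarrow> complex" where "\<alpha> = (\<lambda>_. of_int (p - r))(0 := of_int p, 1 := of_int r)"
  define \<beta> :: "nat \<Rightarrow> complex" where "\<beta> = (\<lambda>_. of_int (s - q))(0 := - of_int q, 1 := - of_int s)"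
  have "linear_factorization 3 b \<alpha> \<beta>"
    unfolding linear_factorization_def ev
    by (simp add: eval_nat_numeral \<alpha>_def \<beta>_def algebra_simps)
  then have "form_disc 3 b = disc_of_factors 3 \<alpha> \<beta>"
    by (rule form_disc_eq)
  also have "\<dots> = of_int (p * s - q * r) ^ 6"
    by (simp add: disc_of_factors_def lessThan_Suc eval_nat_numeral \<alpha>_def \<beta>_def) (simp add: algebra_simps)
  finally have "form_disc 3 b = of_int (p * s - q * r) ^ 6" .
  moreover have "p * s - q * r \<noteq> 0"
    using det by auto
  ultimately show "form_disc 3 b \<noteq> 0"
    by (simp only: power_eq_0_iff of_int_eq_0_iff) simp
  have M: "Measurable.pred borel (\<lambda>(x, y). \<bar>x * y * (x - y)\<bar> \<le> (1::real))"
    unfolding borel_prod[symmetric] by measurable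
  have "\<bar>real_of_int p * real_of_int s - real_of_int q * real_of_int r\<bar> = 1"
    using det by (metis of_int_1 of_int_abs of_int_diff of_int_mult)
  then show "form_area 3 b = ennreal (3 * Beta (1/3) (1/3))"
    unfolding form_area_def ev
    using emeasure_linear_image[OF M, of "of_int p" "of_int s" "of_int q" "of_int r"] emeasure_xy_form_region
    by (auto simp: case_prod_unfold)
qed

section \<open>Averages over the unit circle\<close>

text \<open>Cauchy's formula at the center. The radius stays below 1 because the function used later
  has a singularity on the unit circle.\<close>

lemma norm_mean_value_circle_le:
  assumes hol: "h holomorphic_on ball 0 1" and r: "0 < r" "r < 1"
  shows "ennreal (norm (h 0)) \<le>
    (\<integral>\<^sup>+s. ennreal (indicator {0..1} s * norm (h (of_real r * exp (2 * of_real pi * \<i> * of_real s)))) \<partial>lborel)"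
proof -
  let ?w = "\<lambda>s. of_real r * exp (2 * of_real pi * \<i> * of_real s) :: complex"
  have cont: "continuous_on {0..1} (\<lambda>s. h (?w s))"
  proof (rule continuous_on_compose2[OF holomorphic_on_imp_continuous_on[OF hol]])
    show "?w ` {0..1} \<subseteq> ball 0 1"
      using r by (auto simp: norm_mult)
  qed (intro continuous_intros)
  have "((\<lambda>u. h u / (u - 0)) has_contour_integral (2 * of_real pi * \<i> * h 0)) (circlepath 0 r)"
  proof (rule Cauchy_integral_circlepath_simple)
    show "h holomorphic_on cball 0 r"
      by (rule holomorphic_on_subset[OF hol]) (use r in auto)
  qed (use r in auto)
  then have "((\<lambda>s. h (?w s) / ?w s * (2 * of_real pi * \<i> * ?w s)) has_integral (2 * of_real pi * \<i> * h 0)) {0..1}"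
    unfolding has_contour_integral vector_derivative_circlepath by (simp add: circlepath mult_ac)
  then have "((\<lambda>s. inverse (2 * of_real pi * \<i>) * (h (?w s) / ?w s * (2 * of_real pi * \<i> * ?w s))) has_integral
      inverse (2 * of_real pi * \<i>) * (2 * of_real pi * \<i> * h 0)) {0..1}"
    by (rule has_integral_mult_right)
  then have int: "((\<lambda>s. h (?w s)) has_integral h 0) {0..1}"
    using r by (simp add: field_simps)
  have int': "(\<lambda>s. norm (h (?w s))) integrable_on {0..1}"
    by (intro integrable_continuous_interval continuous_intros cont)
  have "norm (h 0) \<le> integral {0..1} (\<lambda>s. norm (h (?w s)))"
    using integral_norm_bound_integral[OF has_integral_integrable[OF int] int'] int by (simp add: integral_unique)
  also have "ennreal \<dots> = (\<integral>\<^sup>+s. ennreal (indicator {0..1} s * norm (h (?w s))) \<partial>lborel)"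
    using int' by (intro nn_integral_has_integral_lebesgue[symmetric]) (auto simp: has_integral_integrable_integral)
  finally show ?thesis by (simp add: ennreal_leI)
qed

section \<open>Integrability of the singularity on the circle\<close>

text \<open>Jordan's inequality: the sine is concave on [0, pi/2] and so lies above its
  chord.\<close>

lemma sin_pi_ge: "2 * y \<le> sin (pi * y)" if "0 \<le> y" "y \<le> 1 / 2"
proof -
  have "convex_on {0..pi/2} (\<lambda>x. - sin x)"
  proof (rule convex_on_realI)
    show "((\<lambda>x. - sin x) has_real_derivative - cos x) (at x)" for x
      by (auto intro!: derivative_eq_intros)
    show "- cos x \<le> - cos y" if "x \<in> {0..pi/2}" "y \<in> {0..pi/2}" "x \<le> y" for x y
      using that by (simp add: cos_monotone_0_pi_le)
  qed auto
  from convex_onD[OF this, of "2 * y" 0 "pi / 2"] show ?thesis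
    using that by (simp add: mult.commute)
qed

lemma nn_integral_abs_powr_finite: "(\<integral>\<^sup>+s. ennreal (indicator {0..1} s * \<bar>s - k\<bar> powr (-2/3)) \<partial>lborel) < \<infinity>"
  if "\<bar>k\<bar> \<le> 2"
proof -
  have 1: "(\<integral>\<^sup>+s. ennreal (indicator {0..3} s * s powr (-2/3)) \<partial>lborel) < \<infinity>"
    by (subst nn_integral_has_integral_lebesgue[OF _ has_integral_powr_from_0]) auto
  have 2: "(\<integral>\<^sup>+s. ennreal (indicator {0..3} (-s) * (-s) powr (-2/3)) \<partial>lborel) < \<infinity>"
    using 1 by (subst (asm) nn_integral_real_affine[where c = "-1" and t = 0]) auto
  have "(\<integral>\<^sup>+s. ennreal (indicator {0..1} s * \<bar>s - k\<bar> powr (-2/3)) \<partial>lborel) =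
    (\<integral>\<^sup>+s. ennreal (indicator {0..1} (k + s) * \<bar>s\<bar> powr (-2/3)) \<partial>lborel)"
    by (subst nn_integral_real_affine[where c = 1 and t = k]) auto
  \<comment> \<open>A shift by at most 2 keeps the unit interval inside [-3, 3].\<close>
  also have "\<dots> \<le> (\<integral>\<^sup>+s. ennreal (indicator {0..3} s * s powr (-2/3)) +
      ennreal (indicator {0..3} (-s) * (-s) powr (-2/3)) \<partial>lborel)"
    using that by (intro nn_integral_mono) (auto simp: indicator_def abs_if)
  also have "\<dots> = (\<integral>\<^sup>+s. ennreal (indicator {0..3} s * s powr (-2/3)) \<partial>lborel) +
      (\<integral>\<^sup>+s. ennreal (indicator {0..3} (-s) * (-s) powr (-2/3)) \<partial>lborel)"
    by (rule nn_integral_add) auto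
  also have "\<dots> < \<infinity>"
    using 1 2 by (simp add: ennreal_add_eq_top top.not_eq_extremum[symmetric])
  finally show ?thesis .
qed

lemma norm_1_minus_cis:
  "norm (1 - exp (2 * of_real pi * \<i> * of_real x)) = 2 * \<bar>sin (pi * x)\<bar>"
proof -
  have "1 - exp (2 * of_real pi * \<i> * of_real x) = exp (of_real (pi * x) * \<i>) * (exp (- (of_real (pi * x) * \<i>)) - exp (of_real (pi * x) * \<i>))"
    by (simp add: right_diff_distrib exp_add[symmetric] mult_ac)
  also have "exp (- (of_real (pi * x) * \<i>)) - exp (of_real (pi * x) * \<i>) = - (2 * \<i> * of_real (sin (pi * x)))"
    by (simp add: exp_Euler[of "of_real (pi*x)"] exp_Euler[of "of_real (- (pi*x))"] cis_conv_exp complex_eq_iff Re_exp Im_exp mult.commute)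
  finally show ?thesis
    by (simp add: norm_mult)
qed

text \<open>By Jordan's inequality the distance from 1 on the circle is bounded below by the
  distance of the parameter from the nearest integer, and -2/3 > -1. This integral controls the
  dominating function when the radius tends to 1.\<close>

lemma nn_integral_circle_powr_finite:
  assumes \<tau>: "norm \<tau> = 1"
  shows "(\<integral>\<^sup>+s. ennreal (indicator {0..1} s * norm (1 - \<tau> * exp (2 * of_real pi * \<i> * of_real s)) powr (-2/3)) \<partial>lborel) < \<infinity>"
proof -
  obtain k where k: "\<bar>k\<bar> \<le> 1 / 2" "\<tau> = exp (- (2 * of_real pi * \<i> * of_real k))"
  proof
    have "\<bar>Arg \<tau>\<bar> \<le> pi"
      using Arg_bounded[of \<tau>] by auto
    then show "\<bar>- (Arg \<tau> / (2 * pi))\<bar> \<le> 1 / 2"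
      by (simp add: field_simps)
    have "\<tau> \<noteq> 0" using \<tau> by auto
    then show "\<tau> = exp (- (2 * of_real pi * \<i> * of_real (- (Arg \<tau> / (2 * pi)))))"
      using Arg_eq[of \<tau>] \<tau> by simp
  qed
  let ?g = "\<lambda>s j. ennreal (indicator {0..1} s * \<bar>s - (k + j)\<bar> powr (-2/3))"
  have bound: "norm (1 - exp (2 * of_real pi * \<i> * of_real x)) powr (-2/3) \<le>
      \<bar>x\<bar> powr (-2/3) + \<bar>x - 1\<bar> powr (-2/3)"
    if "-1/2 \<le> x" "x \<le> 3/2" for x :: real
  proof -
    \<comment> \<open>\<open>j\<close> is an integer nearest to \<open>x\<close>; on [-1/2, 3/2]
      only 0 and 1 occur.\<close>
    define j :: int where "j = (if x \<le> 1/2 then 0 else 1)"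
    define y where "y = \<bar>x - j\<bar>"
    have y: "0 \<le> y" "y \<le> 1/2"
      using that by (auto simp: y_def j_def abs_if)
    have "\<bar>sin (pi * x)\<bar> = \<bar>sin (pi * (x - j))\<bar>"
      by (auto simp: j_def right_diff_distrib sin_diff)
    also have "\<dots> = \<bar>sin (pi * y)\<bar>"
      unfolding y_def by (cases "x \<ge> j") (simp_all add: abs_minus_commute right_diff_distrib sin_diff)
    finally have s: "y \<le> 2 * \<bar>sin (pi * x)\<bar>"
      using sin_pi_ge[OF y] y by linarith
    have "(2 * \<bar>sin (pi * x)\<bar>) powr (-2/3) \<le> y powr (-2/3)"
    \<comment> \<open>At \<open>y = 0\<close> both powers are 0 by the convention for
      \<open>powr\<close>, so monotonicity is needed only for positive \<open>y\<close>.\<close>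
    proof (cases "y = 0")
      case True
      then have "sin (pi * x) = 0"
        by (auto simp: y_def j_def split: if_splits)
      then show ?thesis by simp
    next
      case False
      then show ?thesis using y s by (intro powr_mono2') auto
    qed
    also have "\<dots> \<le> \<bar>x\<bar> powr (-2/3) + \<bar>x - 1\<bar> powr (-2/3)"
      by (auto simp: y_def j_def)
    finally show ?thesis
      unfolding norm_1_minus_cis .
  qed
  have "(\<integral>\<^sup>+s. ennreal (indicator {0..1} s * norm (1 - \<tau> * exp (2 * of_real pi * \<i> * of_real s)) powr (-2/3)) \<partial>lborel) \<le>
    (\<integral>\<^sup>+s. ?g s 0 + ?g s 1 \<partial>lborel)"
  proof (rule nn_integral_mono)
    fix s :: real
    show "ennreal (indicator {0..1} s * norm (1 - \<tau> * exp (2 * of_real pi * \<i> * of_real s)) powr (-2/3)) \<le>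
      ?g s 0 + ?g s 1"
    proof (cases "s \<in> {0..1}")
      case True
      have "\<tau> * exp (2 * of_real pi * \<i> * of_real s) = exp (2 * of_real pi * \<i> * of_real (s - k))"
        by (simp add: k(2) exp_add[symmetric] right_diff_distrib)
      moreover have "-1/2 \<le> s - k" "s - k \<le> 3/2"
        using True k(1) by (auto simp: abs_le_iff)
      ultimately show ?thesis
        using bound[of "s - k"] True by (simp add: ennreal_plus[symmetric] algebra_simps del: ennreal_plus)
    qed auto
  qed
  also have "\<dots> = (\<integral>\<^sup>+s. ?g s 0 \<partial>lborel) + (\<integral>\<^sup>+s. ?g s 1 \<partial>lborel)"
    by (simp add: nn_integral_add)
  also have "\<dots> < \<infinity>"
    using nn_integral_abs_powr_finite[of "k + 0"] nn_integral_abs_powr_finite[of "k + 1"] k(1)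
    by (simp add: ennreal_add_eq_top top.not_eq_extremum[symmetric])
  finally show ?thesis .
qed

definition unit_circle :: "real \<Rightarrow> complex" where
  "unit_circle s = exp (2 * of_real pi * \<i> * of_real s)"

lemma norm_unit_circle [simp]: "norm (unit_circle s) = 1"
  by (simp add: unit_circle_def)

lemma measurable_unit_circle [measurable]: "unit_circle \<in> borel_measurable borel"
  unfolding unit_circle_def[abs_def] by (intro borel_measurable_continuous_onI continuous_intros)

text \<open>As \<open>0 powr (-2/3) = 0\<close>, domination and convergence can fail at a zero of 1
  - \<tau> w. Such a zero occurs for finitely many parameters only.\<close>

lemma AE_unit_circle_ne: "AE s in lborel. s \<in> {0..1} \<longrightarrow> \<tau> * unit_circle s \<noteq> 1"
proof -
  have inj: "inj_on unit_circle {0..<1}"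
  proof (rule inj_onI)
    fix s t :: real assume st: "s \<in> {0..<1}" "t \<in> {0..<1}" and "unit_circle s = unit_circle t"
    then obtain n :: int where "2 * pi * s = 2 * pi * t + 2 * n * pi"
      unfolding unit_circle_def exp_eq by (auto simp: complex_eq_iff mult_ac)
    then have "pi * s = pi * (t + n)"
      by (simp add: algebra_simps)
    then have *: "s = t + n"
      by simp
    with st have "real_of_int n < 1" "real_of_int n > -1"
      by auto
    then have "n = 0" by linarith
    with * show "s = t" by simp
  qed
  have "finite {s \<in> {0..<1}. \<tau> * unit_circle s = 1}"
  proof (rule finite_imageD)
    show "inj_on unit_circle {s \<in> {0..<1}. \<tau> * unit_circle s = 1}"
      using inj by (rule inj_on_subset) auto
    have "unit_circle ` {s \<in> {0..<1}. \<tau> * unit_circle s = 1} \<subseteq> {inverse \<tau>}"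
      by (auto simp: field_simps) (metis mult_eq_0_iff nonzero_eq_divide_eq one_neq_zero inverse_eq_divide mult.commute)
    then show "finite (unit_circle ` {s \<in> {0..<1}. \<tau> * unit_circle s = 1})"
      by (rule finite_subset) simp
  qed
  then have "AE s in lborel. s \<notin> insert 1 {s \<in> {0..<1}. \<tau> * unit_circle s = 1}"
    by (intro AE_not_in finite_imp_null_set_lborel) simp
  then show ?thesis
    by eventually_elim auto
qed

section \<open>The mean value inequality for products of powers\<close>

text \<open>The bound on \<open>p\<close> makes |(p/q) u| < 1 in the open disc, so 1 + (p/q) u
  avoids the branch cut and its principal powers are holomorphic. Dividing by \<open>q1\<close> and
  \<open>q2\<close> normalizes the center value to \<open>h 0 = 1\<close>.\<close>

lemma circle_average_inside:
  fixes q1 p1 q2 p2 \<tau> :: complex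
  assumes p: "norm p1 \<le> norm q1" "norm p2 \<le> norm q2" and \<tau>: "norm \<tau> = 1" and r: "0 < r" "r < 1"
  shows "ennreal ((norm q1 * norm q2) powr (1/3)) \<le>
    (\<integral>\<^sup>+s. ennreal (indicator {0..1} s * (norm (q1 + p1 * (of_real r * unit_circle s)) powr (1/3) *
      norm (q2 + p2 * (of_real r * unit_circle s)) powr (1/3) *
      norm (1 - \<tau> * (of_real r * unit_circle s)) powr (-2/3))) \<partial>lborel)"
proof (cases "q1 = 0 \<or> q2 = 0")
  case False
  then have q: "q1 \<noteq> 0" "q2 \<noteq> 0"
    by auto
  define k1 k2 where k: "k1 = p1 / q1" "k2 = p2 / q2"
  have k': "norm k1 \<le> 1" "norm k2 \<le> 1" "norm (- \<tau>) \<le> 1"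
    using p \<tau> False by (auto simp: k norm_divide divide_le_eq)
  define h where "h u = (1 + k1 * u) powr (of_real (1/3)) * (1 + k2 * u) powr (of_real (1/3)) * (1 + (- \<tau>) * u) powr (of_real (-2/3))" for u
  have pos: "1 + k * u \<notin> \<real>\<^sub>\<le>\<^sub>0" if "norm k \<le> 1" "u \<in> ball 0 1" for k u :: complex
  proof
    assume "1 + k * u \<in> \<real>\<^sub>\<le>\<^sub>0"
    then have "Re (k * u) \<le> -1"
      by (auto simp: complex_nonpos_Reals_iff)
    then have "norm (k * u) \<ge> 1"
      using abs_Re_le_cmod[of "k * u"] by linarith
    moreover have "norm (k * u) < 1"
      using that mult_mono[of "norm k" 1 "norm u" "norm u"] by (simp add: norm_mult)
    ultimately show False by simp
  qed
  have "h holomorphic_on ball 0 1"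
    unfolding h_def using pos[OF k'(1)] pos[OF k'(2)] pos[OF k'(3)] by (intro holomorphic_intros) auto
  from norm_mean_value_circle_le[OF this r]
  have "1 \<le> (\<integral>\<^sup>+s. ennreal (indicator {0..1} s * norm (h (of_real r * unit_circle s))) \<partial>lborel)" (is "_ \<le> nn_integral _ ?f")
    by (simp add: h_def unit_circle_def)
  then have "ennreal ((norm q1 * norm q2) powr (1/3)) * 1 \<le> ennreal ((norm q1 * norm q2) powr (1/3)) * nn_integral lborel ?f"
    by (rule mult_left_mono) simp
  also have "\<dots> = (\<integral>\<^sup>+s. ennreal ((norm q1 * norm q2) powr (1/3)) * ?f s \<partial>lborel)"
    unfolding h_def norm_mult norm_powr_real_powr'[OF Reals_of_real] Re_complex_of_real
    by (rule nn_integral_cmult[symmetric]) measurable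
  also have "\<dots> = (\<integral>\<^sup>+s. ennreal (indicator {0..1} s * (norm (q1 + p1 * (of_real r * unit_circle s)) powr (1/3) *
      norm (q2 + p2 * (of_real r * unit_circle s)) powr (1/3) *
      norm (1 - \<tau> * (of_real r * unit_circle s)) powr (-2/3))) \<partial>lborel)"
  proof (rule nn_integral_cong)
    fix s
    let ?u = "of_real r * unit_circle s"
    have *: "norm (q + p * ?u) = norm q * norm (1 + p / q * ?u)" if "q \<noteq> 0" for p q
      using that by (simp add: norm_mult[symmetric] distrib_left)
    have "norm (q1 + p1 * ?u) powr (1/3) * norm (q2 + p2 * ?u) powr (1/3) * norm (1 - \<tau> * ?u) powr (-2/3) =
      (norm q1 * norm q2) powr (1/3) * norm (h ?u)"
      unfolding h_def norm_mult norm_powr_real_powr'[OF Reals_of_real] Re_complex_of_real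
        *[OF q(1), of p1] *[OF q(2), of p2] k powr_mult by simp
    then show "ennreal ((norm q1 * norm q2) powr (1/3)) * ?f s =
      ennreal (indicator {0..1} s * (norm (q1 + p1 * ?u) powr (1/3) * norm (q2 + p2 * ?u) powr (1/3) * norm (1 - \<tau> * ?u) powr (-2/3)))"
      by (simp add: ennreal_mult[symmetric] mult_ac)
  qed
  finally show ?thesis by simp
qed auto

text \<open>A lower bound uniform in the radius, which turns into a dominating function under the
  negative exponent.\<close>

lemma norm_1_minus_scaled_ge:
  fixes z :: complex
  assumes z: "norm z = 1" and r: "1/4 \<le> r" "r \<le> 1"
  shows "norm (1 - z * of_real r) \<ge> norm (1 - z) / 2"
proof (rule power2_le_imp_le)
  have zz: "(Re z)\<^sup>2 + (Im z)\<^sup>2 = 1"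
    using z by (simp add: cmod_def)
  have "(norm (1 - z))\<^sup>2 = 2 - 2 * Re z"
    unfolding cmod_power2 using zz by (simp add: power2_diff)
  moreover have "(norm (1 - z * of_real r))\<^sup>2 = 1 - 2 * r * Re z + r\<^sup>2 * ((Re z)\<^sup>2 + (Im z)\<^sup>2)"
    unfolding cmod_power2 by (simp add: power2_diff power_mult_distrib algebra_simps)
  \<comment> \<open>This is exactly the difference of the two squared sides; the constant 1/4 comes
    from it.\<close>
  moreover have "(1 - r)\<^sup>2 + (r - 1/4) * (2 - 2 * Re z) \<ge> 0"
    using r abs_Re_le_cmod[of z] z by (intro add_nonneg_nonneg mult_nonneg_nonneg) auto
  ultimately show "(norm (1 - z) / 2)\<^sup>2 \<le> (norm (1 - z * of_real r))\<^sup>2"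
    unfolding zz by (simp add: power2_diff power_divide algebra_simps)
qed auto

text \<open>The mean value inequality on smaller circles passes to the unit circle by dominated
  convergence, since the limit integrand has an integrable singularity.\<close>

lemma circle_average_dominated:
  fixes q1 p1 q2 p2 \<tau> :: complex
  assumes p: "norm p1 \<le> norm q1" "norm p2 \<le> norm q2" and \<tau>: "norm \<tau> = 1"
  shows "ennreal ((norm q1 * norm q2) powr (1/3)) \<le>
    (\<integral>\<^sup>+s. ennreal (indicator {0..1} s * (norm (q1 + p1 * unit_circle s) powr (1/3) *
      norm (q2 + p2 * unit_circle s) powr (1/3) * norm (1 - \<tau> * unit_circle s) powr (-2/3))) \<partial>lborel)"
    (is "?c \<le> ?I")
proof -
  \<comment> \<open>The radii start at 1/2, inside the range required by
    \<open>norm_1_minus_scaled_ge\<close>.\<close>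
  define \<rho> where "\<rho> k = 1 - inverse (real (Suc (Suc k)))" for k
  have \<rho>: "1/2 \<le> \<rho> k" "\<rho> k < 1" for k
    by (auto simp: \<rho>_def field_simps)
  have \<rho>_lim: "\<rho> \<longlonglongrightarrow> 1"
    unfolding \<rho>_def using tendsto_diff[OF tendsto_const LIMSEQ_Suc[OF LIMSEQ_inverse_real_of_nat], of 1] by simp
  let ?f = "\<lambda>r s. norm (q1 + p1 * (of_real r * unit_circle s)) powr (1/3) *
      norm (q2 + p2 * (of_real r * unit_circle s)) powr (1/3) *
      norm (1 - \<tau> * (of_real r * unit_circle s)) powr (-2/3)"
  let ?C = "(norm q1 + norm p1) powr (1/3) * (norm q2 + norm p2) powr (1/3) * (1/2) powr (-2/3)"
  let ?g = "\<lambda>s. ?C * norm (1 - \<tau> * unit_circle s) powr (-2/3)"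
  have "(\<lambda>k. \<integral>\<^sup>+s. ennreal (indicator {0..1} s * ?f (\<rho> k) s) \<partial>lborel) \<longlonglongrightarrow>
      (\<integral>\<^sup>+s. ennreal (indicator {0..1} s * ?f 1 s) \<partial>lborel)"
  proof (rule nn_integral_dominated_convergence[where w = "\<lambda>s. ennreal (indicator {0..1} s * ?g s)"])
    show "AE s in lborel. ennreal (indicator {0..1} s * ?f (\<rho> k) s) \<le> ennreal (indicator {0..1} s * ?g s)" for k
      using AE_unit_circle_ne[of \<tau>]
    proof eventually_elim
      case (elim s)
      show ?case
      proof (cases "s \<in> {0..1}")
        case True
        have le: "norm (q + p * (of_real (\<rho> k) * unit_circle s)) \<le> norm q + norm p" for q p
          using \<rho>[of k] by (intro order_trans[OF norm_triangle_ineq])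
            (auto simp: norm_mult intro!: mult_left_le)
        have "norm (1 - \<tau> * unit_circle s) > 0"
          using elim True by auto
        moreover have "norm (1 - \<tau> * unit_circle s) / 2 \<le> norm (1 - \<tau> * unit_circle s * of_real (\<rho> k))"
          using \<rho>[of k] \<tau> by (intro norm_1_minus_scaled_ge) (auto simp: norm_mult)
        ultimately have "norm (1 - \<tau> * (of_real (\<rho> k) * unit_circle s)) powr (-2/3) \<le> (1/2 * norm (1 - \<tau> * unit_circle s)) powr (-2/3)"
          by (intro powr_mono2') (auto simp: mult_ac)
        also have "\<dots> = (1/2) powr (-2/3) * norm (1 - \<tau> * unit_circle s) powr (-2/3)"
          by (rule powr_mult)
        finally have "?f (\<rho> k) s \<le> (norm q1 + norm p1) powr (1/3) * (norm q2 + norm p2) powr (1/3) *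
            ((1/2) powr (-2/3) * norm (1 - \<tau> * unit_circle s) powr (-2/3))"
          by (intro mult_mono powr_mono2 le) auto
        then show ?thesis
          using True by (simp add: ennreal_leI mult.assoc)
      qed auto
    qed
    have "(\<integral>\<^sup>+s. ennreal (indicator {0..1} s * ?g s) \<partial>lborel) =
      (\<integral>\<^sup>+s. ennreal ?C * ennreal (indicator {0..1} s * norm (1 - \<tau> * unit_circle s) powr (-2/3)) \<partial>lborel)"
      by (intro nn_integral_cong) (simp add: ennreal_mult[symmetric] mult_ac)
    also have "\<dots> = ennreal ?C * (\<integral>\<^sup>+s. ennreal (indicator {0..1} s * norm (1 - \<tau> * unit_circle s) powr (-2/3)) \<partial>lborel)"
      by (rule nn_integral_cmult) measurable
    also have "\<dots> < \<infinity>"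
      using nn_integral_circle_powr_finite[OF \<tau>] by (simp add: unit_circle_def ennreal_mult_less_top)
    finally show "(\<integral>\<^sup>+s. ennreal (indicator {0..1} s * ?g s) \<partial>lborel) < \<infinity>" .
    show "AE s in lborel. (\<lambda>k. ennreal (indicator {0..1} s * ?f (\<rho> k) s)) \<longlonglongrightarrow> ennreal (indicator {0..1} s * ?f 1 s)"
      using AE_unit_circle_ne[of \<tau>]
    proof eventually_elim
      case (elim s)
      show ?case
      proof (cases "s \<in> {0..1}")
        case True
        then have ne: "norm (1 - \<tau> * (of_real 1 * unit_circle s)) \<noteq> 0"
          using elim by auto
        have lim: "(\<lambda>k. norm (q + p * (of_real (\<rho> k) * unit_circle s))) \<longlonglongrightarrow> norm (q + p * (of_real 1 * unit_circle s))" for p q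
          by (intro tendsto_intros \<rho>_lim)
        have lim': "(\<lambda>k. norm (1 - \<tau> * (of_real (\<rho> k) * unit_circle s))) \<longlonglongrightarrow> norm (1 - \<tau> * (of_real 1 * unit_circle s))"
          by (intro tendsto_intros \<rho>_lim)
        show ?thesis
          by (intro tendsto_ennrealI tendsto_mult tendsto_const tendsto_powr'[OF lim] tendsto_powr[OF lim' _ ne]) auto
      qed auto
    qed
  qed measurable
  then have "?c \<le> (\<integral>\<^sup>+s. ennreal (indicator {0..1} s * ?f 1 s) \<partial>lborel)"
  proof (rule LIMSEQ_le_const)
    show "\<exists>N. \<forall>k\<ge>N. ?c \<le> (\<integral>\<^sup>+s. ennreal (indicator {0..1} s * ?f (\<rho> k) s) \<partial>lborel)"
      using circle_average_inside[OF p \<tau>] \<rho> by (meson less_le_trans zero_less_divide_1_iff zero_less_numeral)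
  qed
  then show ?thesis by simp
qed

text \<open>On the unit circle \<open>q + p w\<close> and \<open>cnj p + cnj q w\<close> have the same modulus, so each factor may be assumed to have no zero inside the disc.\<close>

lemma circle_average:
  fixes q1 p1 q2 p2 \<tau> :: complex
  assumes \<tau>: "norm \<tau> = 1"
  shows "ennreal ((norm q1 * norm q2) powr (1/3)) \<le>
    (\<integral>\<^sup>+s. ennreal (indicator {0..1} s * (norm (q1 + p1 * unit_circle s) powr (1/3) *
      norm (q2 + p2 * unit_circle s) powr (1/3) * norm (1 - \<tau> * unit_circle s) powr (-2/3))) \<partial>lborel)"
proof -
  have swap: "\<exists>q' p'. norm q \<le> norm q' \<and> norm p' \<le> norm q' \<and>
      (\<forall>s. norm (q' + p' * unit_circle s) = norm (q + p * unit_circle s))" for q p :: complex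
  proof (cases "norm p \<le> norm q")
    case False
    have "norm (cnj p + cnj q * unit_circle s) = norm (q + p * unit_circle s)" for s
    proof -
      have u: "unit_circle s * cnj (unit_circle s) = 1"
        using complex_norm_square[of "unit_circle s"] by simp
      have "cnj p + cnj q * unit_circle s = unit_circle s * cnj (q + p * unit_circle s)"
        using u by (simp add: algebra_simps)
      then show ?thesis
        by (simp add: norm_mult del: complex_cnj_add complex_cnj_mult)
    qed
    then show ?thesis
      using False by (intro exI[of _ "cnj p"] exI[of _ "cnj q"]) auto
  qed blast
  obtain q1' p1' where 1: "norm q1 \<le> norm q1'" "norm p1' \<le> norm q1'"
    "\<And>s. norm (q1' + p1' * unit_circle s) = norm (q1 + p1 * unit_circle s)"
    using swap by blast
  obtain q2' p2' where 2: "norm q2 \<le> norm q2'" "norm p2' \<le> norm q2'"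
    "\<And>s. norm (q2' + p2' * unit_circle s) = norm (q2 + p2 * unit_circle s)"
    using swap by blast
  \<comment> \<open>Reflection is applied only if |p| > |q|, so it can only raise the left-hand
    side.\<close>
  have "ennreal ((norm q1 * norm q2) powr (1/3)) \<le> ennreal ((norm q1' * norm q2') powr (1/3))"
    using 1 2 by (intro ennreal_leI powr_mono2 mult_mono) auto
  also have "\<dots> \<le> (\<integral>\<^sup>+s. ennreal (indicator {0..1} s * (norm (q1' + p1' * unit_circle s) powr (1/3) *
      norm (q2' + p2' * unit_circle s) powr (1/3) * norm (1 - \<tau> * unit_circle s) powr (-2/3))) \<partial>lborel)"
    using 1 2 \<tau> by (intro circle_average_dominated)
  finally show ?thesis
    unfolding 1(3) 2(3) .
qed

section \<open>Cubic forms\<close>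

text \<open>This is |D|^(1/6) |F(t, 1)|^(-2/3) for the product F of the three factors, D being the
  square of the product of the three determinants. It has degree 1/3 + 1/3 - 2/3 = 0 in the
  coefficients of each factor, and it is 0 at real roots of F by the convention for
  \<open>powr\<close>.\<close>

definition cubic_integrand ::
  "complex \<Rightarrow> complex \<Rightarrow> complex \<Rightarrow> complex \<Rightarrow> complex \<Rightarrow> complex \<Rightarrow> real \<Rightarrow> real" where
  "cubic_integrand a1 b1 a2 b2 a3 b3 t =
    (norm (a1 * b2 - a2 * b1) * norm (a2 * b3 - a3 * b2) * norm (a3 * b1 - a1 * b3)) powr (1/3) *
    (norm (a1 * of_real t - b1) * norm (a2 * of_real t - b2) * norm (a3 * of_real t - b3)) powr (-2/3)"

text \<open>The real part of \<open>exp (- \<pi> i s) z\<close>.\<close>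

definition rotated_Re :: "real \<Rightarrow> complex \<Rightarrow> real" where
  "rotated_Re s z = Re z * cos (pi * s) + Im z * sin (pi * s)"

text \<open>Twice a real part is a number plus its conjugate. With the half angle pi s, taking out
  exp(-pi i s) leaves an expression affine in \<open>unit_circle s\<close>.\<close>

lemma rotated_Re_eq:
  "complex_of_real (rotated_Re s z) = cis (- (pi * s)) * (z + cnj z * unit_circle s) / 2"
proof -
  have "unit_circle s = cis (2 * (pi * s))"
    by (simp add: unit_circle_def cis_conv_exp mult_ac)
  then have "cis (- (pi * s)) * unit_circle s = cis (pi * s)"
    by (simp add: cis_mult)
  then have "cis (- (pi * s)) * (z + cnj z * unit_circle s) = cis (- (pi * s)) * z + cnj z * cis (pi * s)"
    by (simp add: distrib_left mult.left_commute)
  then show ?thesis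
    by (simp add: rotated_Re_def complex_eq_iff algebra_simps)
qed

text \<open>One formula covers both uses: (u, v) are the coefficients of another factor for a
  determinant, and (t, 1) for the value at t.\<close>

lemma norm_rotated_Re:
  "norm (complex_of_real (rotated_Re s z) * u - complex_of_real (rotated_Re s z') * v) =
    norm ((z * u - z' * v) + (cnj z * u - cnj z' * v) * unit_circle s) / 2"
proof -
  have eq: "complex_of_real (rotated_Re s z) * u - complex_of_real (rotated_Re s z') * v =
    cis (- (pi * s)) * (((z * u - z' * v) + (cnj z * u - cnj z' * v) * unit_circle s) / 2)"
    unfolding rotated_Re_eq by (simp add: field_simps)
  show ?thesis
    unfolding eq by (simp add: norm_mult norm_divide)
qed

text \<open>Since \<open>t\<close> is real, conjugating the coefficients of the first factor
  conjugates its value \<open>l\<close>. The value of the averaged factor is thus proportional to l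
  (1 - \<tau> w) with |\<tau>| = 1, the shape required by \<open>circle_average\<close>.\<close>

lemma cubic_integrand_le_average:
  "ennreal (cubic_integrand a1 b1 a2 b2 a3 b3 t) \<le>
    (\<integral>\<^sup>+s. ennreal (indicator {0..1} s *
      cubic_integrand (of_real (rotated_Re s a1)) (of_real (rotated_Re s b1)) a2 b2 a3 b3 t) \<partial>lborel)"
proof (cases "a1 * of_real t - b1 = 0")
  case False
  define l where "l = a1 * of_real t - b1"
  define \<tau> where "\<tau> = - (cnj l / l)"
  have l: "l \<noteq> 0"
    using False by (simp add: l_def)
  then have \<tau>: "norm \<tau> = 1"
    by (simp add: \<tau>_def norm_divide)
  define q1 q2 p1 p2 where q: "q1 = a1 * b2 - b1 * a2" "q2 = a1 * b3 - b1 * a3"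
    "p1 = cnj a1 * b2 - cnj b1 * a2" "p2 = cnj a1 * b3 - cnj b1 * a3"
  define c where "c = norm (a2 * b3 - a3 * b2) powr (1/3) * (norm l * norm (a2 * of_real t - b2) * norm (a3 * of_real t - b3)) powr (-2/3)"
  let ?f = "\<lambda>s. norm (q1 + p1 * unit_circle s) powr (1/3) * norm (q2 + p2 * unit_circle s) powr (1/3) *
    norm (1 - \<tau> * unit_circle s) powr (-2/3)"
  have "cubic_integrand a1 b1 a2 b2 a3 b3 t = c * (norm q1 * norm q2) powr (1/3)"
    by (simp add: cubic_integrand_def c_def q l_def powr_mult norm_minus_commute mult_ac)
  then have "ennreal (cubic_integrand a1 b1 a2 b2 a3 b3 t) = ennreal c * ennreal ((norm q1 * norm q2) powr (1/3))"
    by (simp add: c_def ennreal_mult[symmetric])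
  also have "\<dots> \<le> ennreal c * (\<integral>\<^sup>+s. ennreal (indicator {0..1} s * ?f s) \<partial>lborel)"
    by (intro mult_left_mono circle_average \<tau>) simp
  also have "\<dots> = (\<integral>\<^sup>+s. ennreal c * ennreal (indicator {0..1} s * ?f s) \<partial>lborel)"
    by (rule nn_integral_cmult[symmetric]) measurable
  also have "\<dots> = (\<integral>\<^sup>+s. ennreal (indicator {0..1} s *
      cubic_integrand (of_real (rotated_Re s a1)) (of_real (rotated_Re s b1)) a2 b2 a3 b3 t) \<partial>lborel)"
  proof (rule nn_integral_cong)
    fix s
    let ?x = "complex_of_real (rotated_Re s a1)" and ?y = "complex_of_real (rotated_Re s b1)"
    have 1: "norm (?x * b2 - a2 * ?y) = 1/2 * norm (q1 + p1 * unit_circle s)"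
      using norm_rotated_Re[of s a1 b2 b1 a2] by (simp add: q mult.commute)
    have 2: "norm (a3 * ?y - ?x * b3) = 1/2 * norm (q2 + p2 * unit_circle s)"
      using norm_rotated_Re[of s a1 b3 b1 a3] by (simp add: q mult.commute norm_minus_commute)
    have "l + cnj l * unit_circle s = l * (1 - \<tau> * unit_circle s)"
      using l by (simp add: \<tau>_def algebra_simps)
    then have 3: "norm (?x * of_real t - ?y) = 1/2 * (norm l * norm (1 - \<tau> * unit_circle s))"
      using norm_rotated_Re[of s a1 "of_real t" b1 1] by (simp add: l_def norm_mult)
    \<comment> \<open>The halves from taking real parts cancel because the exponents add up to
      0.\<close>
    have two: "(1/2) powr (1/3) * (1/2) powr (1/3) * (1/2) powr (-2/3) = (1::real)"
      by (simp add: powr_add[symmetric])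
    have "cubic_integrand ?x ?y a2 b2 a3 b3 t =
      ((1/2) powr (1/3) * (1/2) powr (1/3) * (1/2) powr (-2/3)) * (c * ?f s)"
      unfolding cubic_integrand_def 1 2 3 c_def powr_mult by (simp only: mult_ac)
    then show "ennreal c * ennreal (indicator {0..1} s * ?f s) = ennreal (indicator {0..1} s * cubic_integrand ?x ?y a2 b2 a3 b3 t)"
      unfolding two by (simp add: c_def ennreal_mult[symmetric] mult_ac)
  qed
  finally show ?thesis .
qed (simp add: cubic_integrand_def)

definition cubic_integral :: "complex \<Rightarrow> complex \<Rightarrow> complex \<Rightarrow> complex \<Rightarrow> complex \<Rightarrow> complex \<Rightarrow> ennreal" where
  "cubic_integral a1 b1 a2 b2 a3 b3 = (\<integral>\<^sup>+t. ennreal (cubic_integrand a1 b1 a2 b2 a3 b3 t) \<partial>lborel)"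

lemma cubic_integral_rotate: "cubic_integral a2 b2 a3 b3 a1 b1 = cubic_integral a1 b1 a2 b2 a3 b3"
  by (simp add: cubic_integral_def cubic_integrand_def mult_ac)

text \<open>After Tonelli the averaged bound is a mean, over an interval of length 1, of integrals
  whose first factor is real.\<close>

lemma cubic_integral_le_if_real:
  assumes "\<And>x y :: real. cubic_integral (of_real x) (of_real y) a2 b2 a3 b3 \<le> M"
  shows "cubic_integral a1 b1 a2 b2 a3 b3 \<le> M"
proof -
  let ?K = "\<lambda>s t. ennreal (indicator {0..1} s *
      cubic_integrand (of_real (rotated_Re s a1)) (of_real (rotated_Re s b1)) a2 b2 a3 b3 t)"
  have "cubic_integral a1 b1 a2 b2 a3 b3 \<le> (\<integral>\<^sup>+t. \<integral>\<^sup>+s. ?K s t \<partial>lborel \<partial>lborel)"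
    unfolding cubic_integral_def by (intro nn_integral_mono cubic_integrand_le_average)
  also have "\<dots> = (\<integral>\<^sup>+s. \<integral>\<^sup>+t. ?K s t \<partial>lborel \<partial>lborel)"
    unfolding cubic_integrand_def rotated_Re_def by (rule lborel_pair.Fubini') measurable
  also have "\<dots> \<le> (\<integral>\<^sup>+s. M * indicator {0..1::real} s \<partial>lborel)"
  proof (rule nn_integral_mono)
    fix s :: real
    show "(\<integral>\<^sup>+t. ?K s t \<partial>lborel) \<le> M * indicator {0..1} s"
      using assms by (cases "s \<in> {0..1}") (auto simp: cubic_integral_def)
  qed
  also have "\<dots> = M"
    by (simp add: nn_integral_cmult_indicator)
  finally show ?thesis .
qed

lemma cubic_integral_le: "cubic_integral a1 b1 a2 b2 a3 b3 \<le> ennreal (3 * Beta (1/3) (1/3))"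
proof -
  have "cubic_integral (of_real x1) (of_real y1) (of_real x2) (of_real y2) (of_real x3) (of_real y3) \<le> ennreal (3 * Beta (1/3) (1/3))"
    for x1 y1 x2 y2 x3 y3 :: real
  proof -
    define P where "P = (x1 * y2 - x2 * y1) * (x2 * y3 - x3 * y2) * (x3 * y1 - x1 * y3)"
    have "cubic_integrand (of_real x1) (of_real y1) (of_real x2) (of_real y2) (of_real x3) (of_real y3) t =
      \<bar>P\<bar> powr (1/3) * \<bar>(x1 * t - y1) * (x2 * t - y2) * (x3 * t - y3)\<bar> powr (-2/3)" for t
      unfolding cubic_integrand_def P_def abs_mult
      by (simp only: of_real_mult[symmetric] of_real_diff[symmetric] norm_of_real)
    then show ?thesis
      using nn_integral_real_cubic[of x1 y2 x2 y1 y3 x3] unfolding P_def[symmetric]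
      by (cases "P = 0") (simp_all add: cubic_integral_def)
  qed
  \<comment> \<open>Each application frees the first factor; a cyclic rotation then brings the next
    real factor to the front.\<close>
  then have "cubic_integral (of_real x2) (of_real y2) (of_real x3) (of_real y3) a1 b1 \<le> ennreal (3 * Beta (1/3) (1/3))"
    for x2 y2 x3 y3 :: real and a1 b1
    by (subst cubic_integral_rotate) (rule cubic_integral_le_if_real)
  then have "cubic_integral (of_real x3) (of_real y3) a1 b1 a2 b2 \<le> ennreal (3 * Beta (1/3) (1/3))"
    for x3 y3 :: real and a1 b1 a2 b2
    by (subst cubic_integral_rotate) (rule cubic_integral_le_if_real)
  then show ?thesis
    by (rule cubic_integral_le_if_real)
qed

section \<open>Forms of arbitrary degree\<close>

text \<open>Ordering the triples leaves their mean unchanged, turns sums into nested sums, and makes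
  cyclic shifts bijections.\<close>

definition ordered_triples :: "nat \<Rightarrow> (nat \<times> nat \<times> nat) set" where
  "ordered_triples n = (SIGMA i:{..<n}. SIGMA j:{..<n} - {i}. {..<n} - {i, j})"

lemma finite_ordered_triples: "finite (ordered_triples n)"
  by (simp add: ordered_triples_def)

lemma sum_ordered_triples_fst_snd:
  fixes y :: "nat \<Rightarrow> nat \<Rightarrow> real"
  assumes n: "n \<ge> 2"
  shows "(\<Sum>(i, j, k)\<in>ordered_triples n. y i j) = real (n - 2) * (\<Sum>i<n. \<Sum>j\<in>{..<n} - {i}. y i j)"
proof -
  have card: "card ({..<n} - {i, j}) = n - 2" if "i < n" "j \<in> {..<n} - {i}" for i j
    using that by (simp add: card_Diff_subset)
  have "(\<Sum>(i, j, k)\<in>ordered_triples n. y i j) = (\<Sum>i<n. \<Sum>j\<in>{..<n} - {i}. \<Sum>k\<in>{..<n} - {i, j}. y i j)"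
    unfolding ordered_triples_def
    by (subst sum.Sigma[symmetric], simp, simp, intro sum.cong refl, subst sum.Sigma[symmetric]) auto
  also have "\<dots> = (\<Sum>i<n. \<Sum>j\<in>{..<n} - {i}. real (n - 2) * y i j)"
    by (intro sum.cong refl) (simp add: card)
  finally show ?thesis
    by (simp add: sum_distrib_left)
qed

lemma sum_ordered_triples_rotate:
  "(\<Sum>(i, j, k)\<in>ordered_triples n. f j k i) = (\<Sum>(i, j, k)\<in>ordered_triples n. f i j k)"
  by (rule sum.reindex_bij_witness[where i = "\<lambda>(i, j, k). (k, i, j)" and j = "\<lambda>(i, j, k). (j, k, i)"])
    (auto simp: ordered_triples_def)

lemma sum_ordered_triples_cyclic:
  fixes f :: "nat \<Rightarrow> nat \<Rightarrow> real"
  shows "(\<Sum>(i, j, k)\<in>ordered_triples n. f i j + f j k + f k i) = 3 * (\<Sum>(i, j, k)\<in>ordered_triples n. f i j)"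
proof -
  have "(\<Sum>(i, j, k)\<in>ordered_triples n. f i j + f j k + f k i) =
    (\<Sum>(i, j, k)\<in>ordered_triples n. f i j) + (\<Sum>(i, j, k)\<in>ordered_triples n. f j k) + (\<Sum>(i, j, k)\<in>ordered_triples n. f k i)"
    by (simp add: case_prod_unfold sum.distrib)
  moreover have "(\<Sum>(i, j, k)\<in>ordered_triples n. f j k) = (\<Sum>(i, j, k)\<in>ordered_triples n. f i j)"
    by (rule sum_ordered_triples_rotate[where f = "\<lambda>i j k. f i j"])
  moreover have "(\<Sum>(i, j, k)\<in>ordered_triples n. f k i) = (\<Sum>(i, j, k)\<in>ordered_triples n. f j k)"
    by (rule sum_ordered_triples_rotate[where f = "\<lambda>i j k. f j k"])
  ultimately show ?thesis by simp
qed

lemma card_ordered_triples: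
  assumes "n \<ge> 2"
  shows "real (card (ordered_triples n)) = real n * real (n - 1) * real (n - 2)"
proof -
  have "real (card (ordered_triples n)) = (\<Sum>(i, j, k)\<in>ordered_triples n. 1)"
    by simp
  also have "\<dots> = real (n - 2) * (\<Sum>i<n. \<Sum>j\<in>{..<n} - {i}. 1)"
    by (rule sum_ordered_triples_fst_snd[OF assms])
  also have "(\<Sum>i<n. \<Sum>j\<in>{..<n} - {i}. 1) = (\<Sum>i<n. real (n - 1))"
    by (intro sum.cong refl) simp
  finally show ?thesis
    by (simp only: sum_constant card_lessThan mult_ac)
qed

text \<open>
  Each linear factor occurs in the same number of triples, and so does each pair of factors. Hence the
  left-hand side is the geometric mean of the cubic integrands over all triples of factors.
\<close>

lemma form_integrand_le_mean:
  fixes \<alpha> \<beta> :: "nat \<Rightarrow> complex"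
  assumes n: "n \<ge> 3" and D: "disc_of_factors n \<alpha> \<beta> \<noteq> 0"
  shows "norm (disc_of_factors n \<alpha> \<beta>) powr (1 / (real n * real (n - 1))) *
      (\<Prod>i<n. norm (\<alpha> i * of_real t - \<beta> i)) powr (- 2 / real n) \<le>
    (\<Sum>(i, j, k)\<in>ordered_triples n. 1 / real (card (ordered_triples n)) *
      cubic_integrand (\<alpha> i) (\<beta> i) (\<alpha> j) (\<beta> j) (\<alpha> k) (\<beta> k) t)"
proof (cases "\<exists>i<n. \<alpha> i * of_real t - \<beta> i = 0")
  case True
  then have P0: "(\<Prod>i<n. norm (\<alpha> i * of_real t - \<beta> i)) = 0"
    by (intro prod_zero) auto
  have "0 \<le> (\<Sum>(i, j, k)\<in>ordered_triples n. 1 / real (card (ordered_triples n)) *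
      cubic_integrand (\<alpha> i) (\<beta> i) (\<alpha> j) (\<beta> j) (\<alpha> k) (\<beta> k) t)"
    by (intro sum_nonneg) (auto simp: cubic_integrand_def)
  then show ?thesis unfolding P0 by simp
next
  case False
  define N where "N = real (card (ordered_triples n))"
  \<comment> \<open>In logarithms the comparison of means becomes Jensen's inequality for
    \<open>exp\<close> with equal weights.\<close>
  define x where "x i = ln (norm (\<alpha> i * of_real t - \<beta> i))" for i
  define y where "y i j = ln (norm (\<alpha> i * \<beta> j - \<alpha> j * \<beta> i))" for i j
  have l: "norm (\<alpha> i * of_real t - \<beta> i) > 0" if "i < n" for i
    using False that by auto
  have D': "ordered_disc {..<n} \<alpha> \<beta> \<noteq> 0"
    using D by (simp add: ordered_disc_eq)
  then have d: "norm (\<alpha> i * \<beta> j - \<alpha> j * \<beta> i) > 0" if "i < n" "j < n" "i \<noteq> j" for i j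
    using that by (auto simp: ordered_disc_def)
  have N: "N = real n * real (n - 1) * real (n - 2)" "N > 0"
    using card_ordered_triples[of n] n by (auto simp: N_def)
  define z where "z = (\<lambda>(i, j, k). 1/3 * (y i j + y j k + y k i) - 2/3 * (x i + x j + x k))"
  have G: "cubic_integrand (\<alpha> i) (\<beta> i) (\<alpha> j) (\<beta> j) (\<alpha> k) (\<beta> k) t = exp (z (i, j, k))"
    if "(i, j, k) \<in> ordered_triples n" for i j k
  proof -
    have "i < n" "j < n" "k < n" "i \<noteq> j" "j \<noteq> k" "k \<noteq> i"
      using that by (auto simp: ordered_triples_def)
    with l d show ?thesis
      by (simp add: cubic_integrand_def z_def powr_def x_def y_def ln_mult exp_add[symmetric] algebra_simps)
  qed
  have sx: "(\<Sum>(i, j, k)\<in>ordered_triples n. x i + x j + x k) = 3 * (real (n - 2) * (real (n - 1) * (\<Sum>i<n. x i)))"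
    unfolding sum_ordered_triples_cyclic[where f = "\<lambda>i j. x i"]
    using n by (subst sum_ordered_triples_fst_snd) (auto simp: sum_distrib_left)
  have sy: "(\<Sum>(i, j, k)\<in>ordered_triples n. y i j + y j k + y k i) = 3 * (real (n - 2) * (\<Sum>i<n. \<Sum>j\<in>{..<n} - {i}. y i j))"
    unfolding sum_ordered_triples_cyclic
    using n by (subst sum_ordered_triples_fst_snd) auto
  have "(\<Sum>T\<in>ordered_triples n. z T) = 1/3 * (\<Sum>(i, j, k)\<in>ordered_triples n. y i j + y j k + y k i) -
      2/3 * (\<Sum>(i, j, k)\<in>ordered_triples n. x i + x j + x k)"
    by (simp add: z_def case_prod_unfold sum_subtractf sum_distrib_left)
  \<comment> \<open>The exponents come from (n-2)/N = 1/(n(n-1)) and 2(n-1)(n-2)/N = 2/n.\<close>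
  also have "\<dots> = N * (1 / (real n * real (n - 1)) * (\<Sum>i<n. \<Sum>j\<in>{..<n} - {i}. y i j) - 2 / real n * (\<Sum>i<n. x i))"
    unfolding sx sy N(1) using n by (simp add: field_simps)
  finally have sz: "(\<Sum>T\<in>ordered_triples n. 1 / N * z T) =
      1 / (real n * real (n - 1)) * (\<Sum>i<n. \<Sum>j\<in>{..<n} - {i}. y i j) - 2 / real n * (\<Sum>i<n. x i)"
    unfolding sum_distrib_left[symmetric] using N(2) by simp
  have lnF: "ln (\<Prod>i<n. norm (\<alpha> i * of_real t - \<beta> i)) = (\<Sum>i<n. x i)"
    unfolding x_def by (rule ln_prod) (use l in auto)
  \<comment> \<open>The squares in the discriminant account for both orders of each pair.\<close>
  have "norm (disc_of_factors n \<alpha> \<beta>) = (\<Prod>i<n. \<Prod>j\<in>{..<n} - {i}. norm (\<alpha> i * \<beta> j - \<alpha> j * \<beta> i))"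
    unfolding norm_disc_of_factors ordered_disc_def prod_norm[symmetric]
    by (intro prod.cong refl) (simp add: norm_minus_commute mult.commute)
  also have "ln \<dots> = (\<Sum>i<n. \<Sum>j\<in>{..<n} - {i}. y i j)"
    using d by (subst ln_prod) (auto intro!: prod_pos sum.cong ln_prod simp: y_def)
  finally have lnD: "ln (norm (disc_of_factors n \<alpha> \<beta>)) = (\<Sum>i<n. \<Sum>j\<in>{..<n} - {i}. y i j)" .
  have "(\<Prod>i<n. norm (\<alpha> i * of_real t - \<beta> i)) \<noteq> 0"
    using l by (intro less_imp_neq[symmetric] prod_pos) auto
  then have "norm (disc_of_factors n \<alpha> \<beta>) powr (1 / (real n * real (n - 1))) *
      (\<Prod>i<n. norm (\<alpha> i * of_real t - \<beta> i)) powr (- 2 / real n) = exp (\<Sum>T\<in>ordered_triples n. 1 / N * z T)"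
    unfolding sz using D unfolding powr_def lnD lnF by (simp add: exp_add[symmetric] del: prod_zero_iff)
  also have "\<dots> \<le> (\<Sum>T\<in>ordered_triples n. 1 / N * exp (z T))"
  proof -
    have "ordered_triples n \<noteq> {}"
      using N by (auto simp: N_def)
    moreover have "(\<Sum>T\<in>ordered_triples n. 1 / N) = 1"
      using N(2) by (simp add: N_def)
    ultimately show ?thesis
      using convex_on_sum[OF finite_ordered_triples _ exp_convex, of n "\<lambda>_. 1 / N" z] N(2) by simp
  qed
  also have "\<dots> = (\<Sum>(i, j, k)\<in>ordered_triples n. 1 / N * cubic_integrand (\<alpha> i) (\<beta> i) (\<alpha> j) (\<beta> j) (\<alpha> k) (\<beta> k) t)"
    by (rule sum.cong) (auto simp: G)
  finally show ?thesis
    by (simp add: N_def)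
qed

lemma form_area_eq_nn_integral:
  assumes fac: "linear_factorization n a \<alpha> \<beta>" and n: "n > 0"
    and nz: "\<And>i. i < n \<Longrightarrow> \<alpha> i \<noteq> 0 \<or> \<beta> i \<noteq> 0"
  shows "form_area n a = (\<integral>\<^sup>+t. ennreal ((\<Prod>i<n. norm (\<alpha> i * of_real t - \<beta> i)) powr (- 2 / real n)) \<partial>lborel)"
proof -
  define F :: "real \<times> real \<Rightarrow> real" where "F = (\<lambda>(x, y). eval_form n a x y)"
  have F: "F \<in> borel_measurable borel"
    unfolding F_def eval_form_def borel_prod[symmetric] by measurable
  have "F (c * x, c * y) = c ^ n * F (x, y)" for c x y
  proof -
    have "of_int (a i) * (c * x) ^ (n - i) * (c * y) ^ i = c ^ n * (of_int (a i) * x ^ (n - i) * y ^ i)" if "i \<le> n" for i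
      using that power_add[of c "n - i" i] by (simp add: power_mult_distrib)
    then show ?thesis
      unfolding F_def eval_form_def case_prod_conv sum_distrib_left by (intro sum.cong) auto
  qed
  then have hom: "\<bar>F (c * x, c * y)\<bar> = \<bar>c\<bar> ^ n * \<bar>F (x, y)\<bar>" for c x y
    by (simp add: abs_mult power_abs)
  have F1: "\<bar>F (t, 1)\<bar> = (\<Prod>i<n. norm (\<alpha> i * of_real t - \<beta> i))" for t
  proof -
    have "complex_of_real (F (t, 1)) = eval_form n a (of_real t) 1"
      by (simp add: F_def eval_form_def)
    also have "\<dots> = (\<Prod>i<n. \<alpha> i * of_real t - \<beta> i)"
      using fac by (simp add: linear_factorization_def)
    finally have "norm (complex_of_real (F (t, 1))) = norm (\<Prod>i<n. \<alpha> i * of_real t - \<beta> i)"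
      by simp
    then show ?thesis
      by (simp add: prod_norm)
  qed
  have "AE t in lborel. \<alpha> i * complex_of_real t - \<beta> i \<noteq> 0" if "i < n" for i
  \<comment> \<open>A nonzero complex factor has at most one real root, and if it exists it is this
    point.\<close>
  proof (rule eventually_mono[OF AE_lborel_singleton[of "Re (\<beta> i / \<alpha> i)"]])
    fix t assume t: "t \<noteq> Re (\<beta> i / \<alpha> i)"
    show "\<alpha> i * complex_of_real t - \<beta> i \<noteq> 0"
    proof
      assume "\<alpha> i * complex_of_real t - \<beta> i = 0"
      then have *: "\<beta> i = \<alpha> i * of_real t" by simp
      with nz[OF that] have "\<alpha> i \<noteq> 0" by auto
      with * t show False by simp
    qed
  qed
  then have "AE t in lborel. \<forall>i\<in>{..<n}. \<alpha> i * complex_of_real t - \<beta> i \<noteq> 0"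
    by (intro AE_finite_allI) auto
  then have F0: "AE t in lborel. F (t, 1) \<noteq> 0"
  proof eventually_elim
    case (elim t)
    then have "\<bar>F (t, 1)\<bar> \<noteq> 0"
      unfolding F1 by simp
    then show ?case by simp
  qed
  from emeasure_homogeneous_region[OF F hom F0 n] show ?thesis
    by (simp add: form_area_def F_def[symmetric] F1) (simp add: F_def case_prod_unfold)
qed

lemma form_area_le:
  assumes n: "n \<ge> 3" and D: "form_disc n a \<noteq> 0"
  shows "form_area n a \<le> ennreal (3 * Beta (1/3) (1/3))" (is "_ \<le> ?M")
proof -
  obtain \<alpha> \<beta> where fac: "linear_factorization n a \<alpha> \<beta>"
    using linear_factorization_exists[of n a] n by auto
  have Deq: "form_disc n a = disc_of_factors n \<alpha> \<beta>"
    by (rule form_disc_eq[OF fac])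
  have nz: "\<alpha> i \<noteq> 0 \<or> \<beta> i \<noteq> 0" if "i < n" for i
    using ordered_disc_zero_factor[of "{..<n}" i \<alpha> \<beta>] D that n by (auto simp: Deq ordered_disc_eq)
  let ?T = "ordered_triples n"
  let ?F = "\<lambda>t. (\<Prod>i<n. norm (\<alpha> i * of_real t - \<beta> i)) powr (- 2 / real n)"
  let ?G = "\<lambda>(i, j, k). cubic_integrand (\<alpha> i) (\<beta> i) (\<alpha> j) (\<beta> j) (\<alpha> k) (\<beta> k)"
  have "real (card ?T) > 0"
    using card_ordered_triples[of n] n by auto
  then have T: "card ?T > 0"
    by linarith
  have G0: "?G T t \<ge> 0" for T t
    by (auto simp: cubic_integrand_def split: prod.split)
  have meas: "?G T \<in> borel_measurable lborel" for T
    by (cases T) (simp add: cubic_integrand_def[abs_def])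
  have "form_area n a = (\<integral>\<^sup>+t. ennreal (?F t) \<partial>lborel)"
    using n by (intro form_area_eq_nn_integral[OF fac]) (use nz in auto)
  also have "\<dots> \<le> (\<integral>\<^sup>+t. (\<Sum>T\<in>?T. ennreal (1 / card ?T) * ennreal (?G T t)) \<partial>lborel)"
  proof (rule nn_integral_mono)
    fix t
    \<comment> \<open>Integrality of the coefficients affects the estimate only through this
      bound.\<close>
    have "1 \<le> norm (form_disc n a)"
      using D n by (intro norm_form_disc_ge_1) auto
    then have "1 * ?F t \<le> norm (form_disc n a) powr (1 / (real n * real (n - 1))) * ?F t"
      by (intro mult_right_mono ge_one_powr_ge_zero) auto
    also have "\<dots> \<le> (\<Sum>T\<in>?T. 1 / card ?T * ?G T t)"
      using form_integrand_le_mean[OF n, of \<alpha> \<beta> t] D by (simp add: Deq case_prod_unfold)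
    finally have "ennreal (1 * ?F t) \<le> ennreal (\<Sum>T\<in>?T. 1 / card ?T * ?G T t)"
      by (rule ennreal_leI)
    also have "\<dots> = (\<Sum>T\<in>?T. ennreal (1 / card ?T * ?G T t))"
      by (intro sum_ennreal[symmetric] mult_nonneg_nonneg G0) simp
    also have "\<dots> = (\<Sum>T\<in>?T. ennreal (1 / card ?T) * ennreal (?G T t))"
      by (intro sum.cong refl ennreal_mult G0) simp
    finally show "ennreal (?F t) \<le> (\<Sum>T\<in>?T. ennreal (1 / card ?T) * ennreal (?G T t))"
      unfolding mult_1 .
  qed
  also have "\<dots> = (\<Sum>T\<in>?T. ennreal (1 / card ?T) * (\<integral>\<^sup>+t. ennreal (?G T t) \<partial>lborel))"
    using meas by (simp add: nn_integral_sum nn_integral_cmult)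
  also have "\<dots> \<le> (\<Sum>T\<in>?T. ennreal (1 / card ?T) * ?M)"
    using cubic_integral_le by (intro sum_mono mult_left_mono) (auto simp: cubic_integral_def)
  also have "\<dots> = ennreal (card ?T * (1 / card ?T)) * ?M"
    by (simp add: ennreal_of_nat_eq_real_of_nat ennreal_mult mult.assoc del: times_divide_eq_right)
  also have "\<dots> = ?M"
    using T by simp
  finally show ?thesis .
qed

theorem theorem1:
  shows "(\<forall>(n::nat) (a::nat \<Rightarrow> int). n \<ge> 3 \<longrightarrow> form_disc n a \<noteq> 0 \<longrightarrow>
            form_area n a \<le> ennreal (3 * Beta (1/3) (1/3))) \<and>
         (\<forall>b::nat \<Rightarrow> int. GL2Z_equivalent 3 xy_form b \<longrightarrow>
            form_disc 3 b \<noteq> 0 \<and> form_area 3 b = ennreal (3 * Beta (1/3) (1/3)))"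
  using form_area_le equivalent_xy_form by blast

end
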